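(* Let $p(z)$ be a polynomial of degree $n\geq 2$, let $h(z)\not\equiv 0$ be an entire function with $\rho(h)<n$, and put $A(z)=h(z)e^{p(z)}$. Let $Q(z)$ be a nonconstant polynomial of degree $m$. If $m+2>2n$ and $n\nmid m+2$, then every solution $f\not\equiv 0$ of the equation $$f''+h(z)e^{p(z)}f'+Q(z)f=0$$ is of infinite order.
   Context: All functions are functions of a complex variable $z$; since the coefficients of the equation are entire, all its solutions are entire. For an entire function $g$, let $M(r,g)=\max_{|z|=r}|g(z)|$. The order of growth of $g$ is $$\rho(g)=\limsup_{r\to\infty}\frac{\log^+\log^+ M(r,g)}{\log r}.$$ A solution $f$ is of infinite order if $\rho(f)=\infty$. *)

theory Defs
  imports "HOL-Complex_Analysis.Complex_Analysis"
begin

definition max_modulus :: "real \<Rightarrow> (complex \<Rightarrow> complex) \<Rightarrow> real" where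
  "max_modulus r g = (SUP z\<in>sphere 0 r. norm (g z))"

definition log_plus :: "real \<Rightarrow> real" where
  "log_plus x = ln (max 1 x)"

definition growth_order :: "(complex \<Rightarrow> complex) \<Rightarrow> ereal" where
  "growth_order g =
     Limsup at_top (\<lambda>r::real. ereal (log_plus (log_plus (max_modulus r g)) / ln r))"

definition is_entire_solution ::
    "(complex \<Rightarrow> complex) \<Rightarrow> (complex \<Rightarrow> complex) \<Rightarrow> (complex \<Rightarrow> complex) \<Rightarrow> bool" where
  "is_entire_solution A B f \<longleftrightarrow>
     f holomorphic_on UNIV \<and> (\<forall>z. deriv (deriv f) z + A z * deriv f z + B z * f z = 0)"

end

theory Submission
  imports Defs "HOL-Real_Asymp.Real_Asymp"
begin

text \<open>Suppose \<open>f\<close> has finite order, and put \<open>\<rho> = (m + 2) / 2 > n\<close>. The plane is divided into \<open>2 n\<close>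
  sectors of opening \<open>\<pi> / n\<close> on which \<open>e\<^sup>p\<close> is alternately large and small. Where it is large, the
  equation read as \<open>f' = - (f'' + Q f) / A\<close> and iterated on shrinking discs gives
  \<open>|f'| \<le> 1 + |f|\<close>, so \<open>f\<close> is at most exponential there. Where it is small,
  \<open>f'' + Q f \<approx> 0\<close>, and on each ray that is not a Stokes ray of \<open>Q\<close> the solution grows or decays
  like \<open>exp (\<plusminus> \<kappa> r\<^sup>\<rho>)\<close>. Suppose a common boundary ray of two such sectors is not a Stokes ray.
  If \<open>f\<close> grows next to it, then \<open>f\<close> times the decaying exponential \<open>exp (- \<Lambda> z\<^sup>\<rho> / \<rho>)\<close> violates the
  Phragmen--Lindelof principle in a narrow sector about that ray. If \<open>f\<close> decays, the decay
  spreads over the neighbouring sector, whose opening \<open>\<pi> / n\<close> exceeds \<open>\<pi> / \<rho>\<close>, and \<open>f = 0\<close>. Finally,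
  boundary rays at distance \<open>2 \<pi> / n\<close> can both be Stokes rays only if \<open>n\<close> divides \<open>m + 2\<close>.

  Phragmen--Lindelof arguments are carried out for \<open>\<zeta> \<mapsto> f (exp \<zeta>)\<close>, which turns sectors into strips
  and makes \<open>z\<^sup>\<rho>\<close> entire.\<close>

text \<open>Finite order is used twice. It bounds \<open>f'\<close> by \<open>4 ^ N\<close> on unit
  discs at distance r, with N of size \<open>r powr K\<close>; each use of the equation gains a
  factor 4 while the disc shrinks by 1/N, so Cauchy's estimate costs only powers of r against an
  exponentially large coefficient. It also licenses the Phragmen-Lindelof principle, but only in
  openings below pi/K, and K may far exceed \<rho>; hence decay is carried across a sector in many
  narrow overlapping strips. The obstacle to dividing by the coefficient is the zeros of
  \<open>h\<close>. Every point far out is enclosed by a tiny circle on which \<open>h\<close> is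
  not too small, and the maximum principle for \<open>f'\<close> brings the estimate inside. The
  upper bound on a ray is sharp up to \<open>exp (E * r powr s)\<close> with s = \<rho> - 1.
  Dividing by the growing exponential therefore leaves growth of order s on the side where
  \<open>e^p\<close> is small, whereas on the other side, where f has order at most 1, it leaves
  decay of order \<rho>. That decay spreads to a ray on which f was assumed to grow.\<close>

lemma growth_order_less_imp_bound:
  assumes g: "g holomorphic_on UNIV" and K: "growth_order g < ereal K"
  obtains R where "R \<ge> 1" "\<And>z. norm z \<ge> R \<Longrightarrow> norm (g z) \<le> exp (norm z powr K)"
proof -
  have "eventually (\<lambda>r::real. ereal (log_plus (log_plus (max_modulus r g)) / ln r) < ereal K) at_top"
    using K unfolding growth_order_def by (rule Limsup_lessD)
  then obtain R0 where R0: "\<And>r. r \<ge> R0 \<Longrightarrow> log_plus (log_plus (max_modulus r g)) / ln r < K"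
    unfolding eventually_at_top_linorder by auto
  \<comment> \<open>The threshold 2 makes \<open>ln r\<close> positive, so the quotient in the
    definition of the order can be cleared.\<close>
  have "norm (g z) \<le> exp (norm z powr K)" if z: "norm z \<ge> max R0 2" for z
  proof -
    define r where "r = norm z"
    define L where "L = log_plus (max_modulus r g)"
    have r: "r \<ge> R0" "r \<ge> 2" using z r_def by auto
    have lnr: "ln r > 0" using r by simp
    have "log_plus L < K * ln r" using R0[OF r(1)] lnr L_def by (simp add: field_simps)
    then have "exp (ln (max 1 L)) < exp (K * ln r)" unfolding log_plus_def exp_less_cancel_iff .
    then have "L < r powr K" using r by (simp add: powr_def)
    then have "exp (ln (max 1 (max_modulus r g))) < exp (r powr K)" unfolding L_def log_plus_def exp_less_cancel_iff .
    then have "max_modulus r g < exp (r powr K)" by simp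
    moreover have "norm (g z) \<le> max_modulus r g"
      unfolding max_modulus_def
    proof (rule cSUP_upper)
      show "z \<in> sphere 0 r" by (simp add: r_def)
      have "continuous_on (sphere 0 r) (\<lambda>z. norm (g z))"
        using holomorphic_on_imp_continuous_on[OF g] continuous_on_subset
        by (intro continuous_intros) blast
      then show "bdd_above ((\<lambda>z. norm (g z)) ` sphere 0 r)"
        by (intro bounded_imp_bdd_above compact_imp_bounded compact_continuous_image compact_sphere)
    qed
    ultimately show ?thesis by (simp add: r_def)
  qed
  then show thesis using that[of "max R0 2"] by simp
qed

section \<open>Phragmen--Lindelof principles in strips\<close>

lemma maximum_modulus_rectangle:
  assumes G: "G holomorphic_on UNIV"
    and a: "\<And>x. x0 \<le> x \<Longrightarrow> x \<le> X \<Longrightarrow> norm (G (Complex x a)) \<le> M"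
    and b: "\<And>x. x0 \<le> x \<Longrightarrow> x \<le> X \<Longrightarrow> norm (G (Complex x b)) \<le> M"
    and l: "\<And>t. a \<le> t \<Longrightarrow> t \<le> b \<Longrightarrow> norm (G (Complex x0 t)) \<le> M"
    and r: "\<And>t. a \<le> t \<Longrightarrow> t \<le> b \<Longrightarrow> norm (G (Complex X t)) \<le> M"
    and "x0 \<le> x" "x \<le> X" "a \<le> t" "t \<le> b"
  shows "norm (G (Complex x t)) \<le> M"
proof (rule maximum_modulus_frontier[of G "cbox (Complex x0 a) (Complex X b)"])
  show "Complex x t \<in> cbox (Complex x0 a) (Complex X b)"
    using assms by (simp add: in_cbox_complex_iff)
  show "G holomorphic_on interior (cbox (Complex x0 a) (Complex X b))"
    using G holomorphic_on_subset by blast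
  show "continuous_on (closure (cbox (Complex x0 a) (Complex X b))) G"
    using holomorphic_on_imp_continuous_on[OF G] continuous_on_subset by blast
  fix z assume "z \<in> frontier (cbox (Complex x0 a) (Complex X b))"
  then have z: "z \<in> cbox (Complex x0 a) (Complex X b)" "z \<notin> box (Complex x0 a) (Complex X b)"
    by (auto simp: frontier_def)
  obtain u v where uv: "z = Complex u v" by (cases z)
  show "norm (G z) \<le> M"
    using z a b l r uv by (auto simp: in_cbox_complex_iff in_box_complex_iff not_less)
qed simp

lemma Re_mult_exp_Complex:
  "Re (exp (of_real s * (Complex x t - \<i> * of_real u))) = exp (s * x) * cos (s * (t - u))"
  by (simp add: Re_exp)

text \<open>Serves to absorb lower-order terms: with r = exp x, a term in
  \<open>r powr \<sigma>\<close> disappears into an arbitrarily small multiple of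
  \<open>r powr \<rho>\<close>, at the price of a constant.\<close>

lemma exp_gap:
  fixes D e \<sigma> \<rho> :: real
  assumes "0 \<le> \<sigma>" "\<sigma> < \<rho>" "0 < e" "0 \<le> D"
  obtains B where "\<And>x. D * exp (\<sigma> * x) \<le> e * exp (\<rho> * x) + B"
proof -
  \<comment> \<open>\<open>X\<close> is the point where \<open>e * exp (\<rho> * x)\<close>
    overtakes \<open>(D+1) * exp (\<sigma> * x)\<close>; \<open>D+1\<close> keeps the logarithm
    meaningful for D = 0.\<close>
  define X where "X = ln ((D+1)/e) / (\<rho> - \<sigma>)"
  have "D * exp (\<sigma> * x) \<le> e * exp (\<rho> * x) + D * exp (\<sigma> * X)" for x
  proof (cases "x \<le> X")
    case True
    then have "D * exp (\<sigma> * x) \<le> D * exp (\<sigma> * X)"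
      using assms by (intro mult_left_mono) (auto intro: mult_left_mono)
    then show ?thesis using assms by (smt (verit) exp_gt_zero mult_pos_pos)
  next
    case False
    then have "ln ((D+1)/e) < (\<rho> - \<sigma>) * x" using assms by (simp add: X_def field_simps)
    then have "(D+1)/e < exp ((\<rho> - \<sigma>) * x)" using assms
      by (metis add_nonneg_pos divide_pos_pos exp_less_mono exp_ln zero_less_one)
    then have "D \<le> e * exp ((\<rho> - \<sigma>) * x)" using assms by (simp add: field_simps)
    then have "D * exp (\<sigma> * x) \<le> e * exp ((\<rho> - \<sigma>) * x) * exp (\<sigma> * x)" by simp
    also have "\<dots> = e * exp (\<rho> * x)" by (simp add: exp_add[symmetric] algebra_simps)
    finally show ?thesis using assms by (smt (verit) exp_gt_zero mult_nonneg_nonneg)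
  qed
  then show thesis using that by blast
qed

text \<open>The interior growth has rate \<open>K\<close> below the critical
  \<open>pi / (b - a)\<close>, which leaves room for a damping factor of slightly larger rate
  \<open>K'\<close> whose exponent keeps one sign across the strip. It beats the growth on a far
  right edge, and letting its weight \<epsilon> tend to 0 removes it again.\<close>

lemma Phragmen_Lindelof_strip:
  assumes G: "G holomorphic_on UNIV" and ab: "a < b" and K: "K * (b - a) < pi" "0 \<le> K"
    and ea: "\<And>x. x0 \<le> x \<Longrightarrow> norm (G (Complex x a)) \<le> M"
    and eb: "\<And>x. x0 \<le> x \<Longrightarrow> norm (G (Complex x b)) \<le> M"
    and gr: "\<And>x t. x0 \<le> x \<Longrightarrow> a \<le> t \<Longrightarrow> t \<le> b \<Longrightarrow> norm (G (Complex x t)) \<le> exp (C + D * exp (K * x))"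
    and D: "0 \<le> D"
  obtains M' where "\<And>x t. x0 \<le> x \<Longrightarrow> a \<le> t \<Longrightarrow> t \<le> b \<Longrightarrow> norm (G (Complex x t)) \<le> M'"
proof -
  \<comment> \<open>\<open>S\<close> bounds \<open>G\<close> on the left edge x = x0, and its
    positivity makes \<open>ln M'\<close> meaningful below.\<close>
  define S where "S = exp (C + D * exp (K * x0))"
  define M' where "M' = max M S"
  have KK: "K < pi / (b-a)" using ab K by (simp add: field_simps)
  obtain K' where K': "K < K'" "K' < pi / (b-a)" using dense[OF KK] by blast
  define c where "c = (a+b)/2"
  define k where "k = cos (K' * (b-a)/2)"
  have K'b: "K' * (b-a)/2 < pi/2" using K'(2) ab by (simp add: field_simps)
  have K'0: "0 < K'" using K K' by linarith
  have k: "k > 0" unfolding k_def using K'b ab K'0 by (intro cos_gt_zero_pi) (auto intro: less_le_trans[of _ 0])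
  have cosk: "k \<le> cos (K' * (t - c))" if "a \<le> t" "t \<le> b" for t
  proof -
    have "\<bar>t - c\<bar> \<le> (b-a)/2" using that by (auto simp: c_def field_simps abs_le_iff)
    then have "\<bar>K' * (t - c)\<bar> \<le> K' * (b-a)/2"
      using K'0 by (simp add: abs_mult mult_left_mono)
    moreover have "cos (K' * (t - c)) = cos \<bar>K' * (t - c)\<bar>" by (auto simp: abs_if)
    ultimately show ?thesis unfolding k_def using K'b pi_gt_zero
      by (metis abs_ge_zero cos_monotone_0_pi_le half_gt_zero_iff less_eq_real_def less_trans field_sum_of_halves less_add_same_cancel1)
  qed
  have main: "norm (G (Complex x t)) \<le> M'" if xt: "x0 \<le> x" "a \<le> t" "t \<le> b" for x t
  proof -
    have eps: "norm (G (Complex x t)) * exp (- \<epsilon> * (exp (K' * x) * cos (K' * (t - c)))) \<le> M'" if \<epsilon>: "\<epsilon> > 0" for \<epsilon>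
    proof -
      define H where "H = (\<lambda>z. G z * exp (- of_real \<epsilon> * exp (of_real K' * (z - \<i> * of_real c))))"
      have H: "H holomorphic_on UNIV" unfolding H_def by (intro holomorphic_intros G)
      have nH: "norm (H (Complex x t)) = norm (G (Complex x t)) * exp (- \<epsilon> * (exp (K' * x) * cos (K' * (t - c))))" for x t
        unfolding H_def norm_mult norm_exp_eq_Re
        using Re_mult_exp_Complex[of K' x t c] by simp
      have HG: "norm (H (Complex x t)) \<le> norm (G (Complex x t))" if "a \<le> t" "t \<le> b" for x t
      proof -
        have "0 \<le> \<epsilon> * (exp (K' * x) * cos (K' * (t - c)))" using \<epsilon> cosk[OF that] k by simp
        then show ?thesis unfolding nH by (simp add: mult_left_le)
      qed
      obtain B where B: "\<And>x. D * exp (K * x) \<le> (\<epsilon> * k / 2) * exp (K' * x) + B"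
        using exp_gap[of K K' "\<epsilon>*k/2" D] K K' D \<epsilon> k by auto
      have "eventually (\<lambda>y. C + B - (\<epsilon> * k / 2) * exp (K' * y) \<le> ln M') at_top"
      proof -
        have "filterlim (\<lambda>y. (\<epsilon> * k / 2) * exp (K' * y)) at_top at_top"
          using \<epsilon> k K'0 by (intro filterlim_tendsto_pos_mult_at_top[OF tendsto_const] filterlim_compose[OF exp_at_top] filterlim_ident) auto
        then have "eventually (\<lambda>y. C + B - ln M' \<le> (\<epsilon> * k / 2) * exp (K' * y)) at_top"
          unfolding filterlim_at_top by blast
        then show ?thesis by (rule eventually_mono) simp
      qed
      then obtain X where X: "X \<ge> x" "C + B - (\<epsilon> * k / 2) * exp (K' * X) \<le> ln M'"
        using eventually_happens'[OF _ eventually_conj[OF _ eventually_ge_at_top[of x]]] by (metis trivial_limit_at_top_linorder)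
      have "0 < S" "S \<le> M'" by (simp_all add: M'_def S_def)
      then have M'0: "M' > 0" by linarith
      have "norm (H (Complex x t)) \<le> M'"
      proof (rule maximum_modulus_rectangle[OF H, of x0 X a M' b])
        show "norm (H (Complex y a)) \<le> M'" if "x0 \<le> y" "y \<le> X" for y
          using HG[of a y] ea[of y] that ab M'_def by auto
        show "norm (H (Complex y b)) \<le> M'" if "x0 \<le> y" "y \<le> X" for y
          using HG[of b y] eb[of y] that ab M'_def by auto
        show "norm (H (Complex x0 t)) \<le> M'" if "a \<le> t" "t \<le> b" for t
          using HG[of t x0] gr[of x0 t] that M'_def S_def by auto
        show "norm (H (Complex X t)) \<le> M'" if t: "a \<le> t" "t \<le> b" for t
        proof -
          have "norm (H (Complex X t)) \<le> exp (C + D * exp (K * X)) * exp (- \<epsilon> * (exp (K' * X) * k))"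
            unfolding nH using gr[of X t] t X xt cosk[OF t] \<epsilon> by (intro mult_mono) auto
          also have "\<dots> = exp (C + D * exp (K * X) - \<epsilon> * k * exp (K' * X))"
            by (simp add: exp_add[symmetric] algebra_simps)
          also have "\<dots> \<le> exp (C + B - (\<epsilon> * k / 2) * exp (K' * X))"
            using B[of X] by simp
          also have "\<dots> \<le> exp (ln M')" using X by simp
          finally show ?thesis using M'0 by simp
        qed
      qed (use xt X in auto)
      then show ?thesis unfolding nH .
    qed
    have "((\<lambda>\<epsilon>. norm (G (Complex x t)) * exp (- \<epsilon> * (exp (K' * x) * cos (K' * (t - c))))) \<longlongrightarrow>
       norm (G (Complex x t)) * exp (- 0 * (exp (K' * x) * cos (K' * (t - c))))) (at_right 0)"
      by (intro tendsto_intros)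
    then have "norm (G (Complex x t)) * exp (- 0 * (exp (K' * x) * cos (K' * (t - c)))) \<le> M'"
      by (rule tendsto_upperbound) (use eps in \<open>auto intro!: eventually_at_rightI[of 0 1]\<close>)
    then show ?thesis by simp
  qed
  then show thesis using that by blast
qed

text \<open>Decay on one edge, compared with \<open>exp (c e\<^sup>\<rho>\<^sup>x sin (\<rho> (\<tau> - t)))\<close> where the sine
  changes sign strictly between the target range and the other edge.\<close>

lemma Phragmen_Lindelof_strip_decay:
  assumes G: "G holomorphic_on UNIV" and ab: "a < g" "g < b"
    and K: "K * (b - a) < pi" "\<rho> \<le> K" and \<sigma>: "0 \<le> \<sigma>" "\<sigma> < \<rho>"
    and c: "0 < c"
    and ea: "\<And>x. x0 \<le> x \<Longrightarrow> norm (G (Complex x a)) \<le> exp (Ca - c * exp (\<rho> * x))"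
    and eb: "\<And>x. x0 \<le> x \<Longrightarrow> norm (G (Complex x b)) \<le> exp (Cb + Db * exp (\<sigma> * x))"
    and gr: "\<And>x t. x0 \<le> x \<Longrightarrow> a \<le> t \<Longrightarrow> t \<le> b \<Longrightarrow> norm (G (Complex x t)) \<le> exp (C + D * exp (K * x))"
    and D: "0 \<le> D" "0 \<le> Db" and x0: "0 \<le> x0"
  obtains C' c' where "c' > 0" "\<And>x t. x0 \<le> x \<Longrightarrow> a \<le> t \<Longrightarrow> t \<le> g \<Longrightarrow>
     norm (G (Complex x t)) \<le> exp (C' - c' * exp (\<rho> * x))"
proof -
  define \<tau> where "\<tau> = (g + b) / 2"
  \<comment> \<open>The shift by \<open>pi / (2 * \<rho>)\<close> turns the cosine of
    \<open>Re_mult_exp_Complex\<close> into \<open>sin (\<rho> * (\<tau> - t))\<close>. The weight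
    \<open>c\<close> is the largest that the decay on the edge \<open>a\<close> can pay for.\<close>
  define H where "H = (\<lambda>z. G z * exp (of_real c * exp (of_real \<rho> * (z - \<i> * of_real (\<tau> - pi/(2*\<rho>))))))"
  have \<rho>: "\<rho> > 0" using \<sigma> by simp
  have H: "H holomorphic_on UNIV" unfolding H_def by (intro holomorphic_intros G)
  have cs: "cos (\<rho> * (t - (\<tau> - pi/(2*\<rho>)))) = sin (\<rho> * (\<tau> - t))" for t
  proof -
    have "\<rho> * (t - (\<tau> - pi/(2*\<rho>))) = pi/2 - \<rho> * (\<tau> - t)" using \<rho> by (simp add: field_simps)
    then show ?thesis by (simp add: sin_cos_eq)
  qed
  have nH: "norm (H (Complex x t)) = norm (G (Complex x t)) * exp (c * (exp (\<rho> * x) * sin (\<rho> * (\<tau> - t))))" for x t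
    unfolding H_def norm_mult norm_exp_eq_Re
    using Re_mult_exp_Complex[of \<rho> x t "\<tau> - pi/(2*\<rho>)"] cs by simp
  have \<rho>ab: "\<rho> * (b - a) < pi" using K ab \<rho> by (smt (verit) mult_right_mono)
  have small: "\<rho> * y < pi" if "y \<le> b - a" for y
    using \<rho>ab \<rho> that by (smt (verit) mult_left_mono)
  define k where "k = sin (\<rho> * (b - \<tau>))"
  have k: "k > 0" unfolding k_def \<tau>_def using small[of "b-\<tau>"] ab \<rho>
    by (intro sin_gt_zero) (auto simp: \<tau>_def)
  obtain B where B: "\<And>x. Db * exp (\<sigma> * x) \<le> (c * k) * exp (\<rho> * x) + B"
    using exp_gap[of \<sigma> \<rho> "c*k" Db] \<sigma> c k D by auto
  define M where "M = exp (max Ca (Cb + B))"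
  obtain M' where M': "\<And>x t. x0 \<le> x \<Longrightarrow> a \<le> t \<Longrightarrow> t \<le> b \<Longrightarrow> norm (H (Complex x t)) \<le> M'"
  proof (rule Phragmen_Lindelof_strip[OF H, of a b K x0 M C "D + c"])
    fix x assume x: "x0 \<le> x"
    have "norm (H (Complex x a)) \<le> exp (Ca - c * exp (\<rho> * x)) * exp (c * (exp (\<rho> * x) * 1))"
      unfolding nH using ea[OF x] c by (intro mult_mono) auto
    also have "\<dots> = exp Ca" by (simp add: exp_add[symmetric])
    finally show "norm (H (Complex x a)) \<le> M" unfolding M_def
      by (rule order_trans) simp
    have "sin (\<rho> * (\<tau> - b)) = - k" unfolding k_def by (metis minus_diff_eq mult_minus_right sin_minus)
    then have "norm (H (Complex x b)) \<le> exp (Cb + Db * exp (\<sigma> * x)) * exp (- c * k * exp (\<rho> * x))"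
      unfolding nH using eb[OF x] c by (intro mult_mono) auto
    also have "\<dots> = exp (Cb + Db * exp (\<sigma> * x) - c * k * exp (\<rho> * x))" by (simp add: exp_add[symmetric])
    also have "\<dots> \<le> M" unfolding M_def using B[of x] by simp
    finally show "norm (H (Complex x b)) \<le> M" .
    fix t assume t: "a \<le> t" "t \<le> b"
    have "exp (\<rho> * x) * sin (\<rho> * (\<tau> - t)) \<le> exp (K * x) * 1"
      using K x x0 by (intro order_trans[OF mult_left_mono[OF sin_le_one]]) (auto simp: mult_right_mono)
    then have "norm (H (Complex x t)) \<le> exp (C + D * exp (K * x)) * exp (c * exp (K * x))"
      unfolding nH using gr[OF x t] c by (intro mult_mono) auto
    then show "norm (H (Complex x t)) \<le> exp (C + (D + c) * exp (K * x))"
      by (simp add: exp_add[symmetric] algebra_simps)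
  qed (use ab K \<rho> c D in auto)
  \<comment> \<open>The sine is unimodal on [0, pi], so its minimum over the target range is
    attained on one of the two bounding lines.\<close>
  define k2 where "k2 = min (sin (\<rho> * (\<tau> - a))) (sin (\<rho> * (\<tau> - g)))"
  have k2: "k2 > 0" unfolding k2_def using small[of "\<tau> - a"] small[of "\<tau> - g"] ab \<rho>
    by (auto intro!: sin_gt_zero simp: \<tau>_def)
  have sink2: "k2 \<le> sin (\<rho> * (\<tau> - t))" if t: "a \<le> t" "t \<le> g" for t
  proof -
    have "0 < \<tau> - g" "\<tau> - g \<le> \<tau> - t" "\<tau> - t \<le> \<tau> - a" "\<tau> - a \<le> b - a"
      using ab t unfolding \<tau>_def by (auto simp: field_simps)
    then have 1: "0 < \<rho> * (\<tau> - g)" "\<rho> * (\<tau> - g) \<le> \<rho> * (\<tau> - t)" "\<rho> * (\<tau> - t) \<le> \<rho> * (\<tau> - a)" "\<rho> * (\<tau> - a) < pi"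
      using small[of "\<tau> - a"] \<rho> by (auto intro: mult_left_mono)
    show ?thesis
    proof (cases "\<rho> * (\<tau> - t) \<le> pi/2")
      case True
      have "sin (\<rho> * (\<tau> - g)) \<le> sin (\<rho> * (\<tau> - t))" using 1 True by (intro sin_monotone_2pi_le) auto
      then show ?thesis by (simp add: k2_def)
    next
      case False
      have "sin (pi - \<rho> * (\<tau> - a)) \<le> sin (pi - \<rho> * (\<tau> - t))" using 1 False by (intro sin_monotone_2pi_le) auto
      then show ?thesis by (simp add: k2_def)
    qed
  qed
  have "norm (G (Complex x t)) \<le> exp (ln (max M' 1) - c * k2 * exp (\<rho> * x))"
    if x: "x0 \<le> x" and t: "a \<le> t" "t \<le> g" for x t
  proof -
    have "norm (G (Complex x t)) * exp (c * k2 * exp (\<rho> * x)) \<le> norm (H (Complex x t))"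
      unfolding nH using sink2[OF t] c by (intro mult_left_mono) auto
    also have "\<dots> \<le> max M' 1" using M'[of x t] x t ab by auto
    finally have "norm (G (Complex x t)) \<le> max M' 1 * exp (- (c * k2 * exp (\<rho> * x)))"
      by (simp add: exp_minus field_simps)
    then show ?thesis by (simp add: exp_diff exp_minus divide_inverse)
  qed
  moreover have "c * k2 > 0" using c k2 by simp
  ultimately show thesis using that by blast
qed

text \<open>Mirror image of the preceding principle, for carrying decay towards smaller angles.
  Conjugating argument and value preserves holomorphy and replaces t by -t.\<close>

lemma Phragmen_Lindelof_strip_decay_down:
  assumes G: "G holomorphic_on UNIV" and ab: "b < g" "g < a"
    and K: "K * (a - b) < pi" "\<rho> \<le> K" and \<sigma>: "0 \<le> \<sigma>" "\<sigma> < \<rho>"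
    and c: "0 < c"
    and ea: "\<And>x. x0 \<le> x \<Longrightarrow> norm (G (Complex x a)) \<le> exp (Ca - c * exp (\<rho> * x))"
    and eb: "\<And>x. x0 \<le> x \<Longrightarrow> norm (G (Complex x b)) \<le> exp (Cb + Db * exp (\<sigma> * x))"
    and gr: "\<And>x t. x0 \<le> x \<Longrightarrow> b \<le> t \<Longrightarrow> t \<le> a \<Longrightarrow> norm (G (Complex x t)) \<le> exp (C + D * exp (K * x))"
    and D: "0 \<le> D" "0 \<le> Db" and x0: "0 \<le> x0"
  obtains C' c' where "c' > 0" "\<And>x t. x0 \<le> x \<Longrightarrow> g \<le> t \<Longrightarrow> t \<le> a \<Longrightarrow>
     norm (G (Complex x t)) \<le> exp (C' - c' * exp (\<rho> * x))"
proof -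
  define F where "F = cnj \<circ> G \<circ> cnj"
  have F: "F holomorphic_on UNIV" unfolding F_def
    by (rule holomorphic_on_compose_cnj_cnj) (auto intro: holomorphic_on_subset[OF G])
  have nF: "norm (F (Complex x t)) = norm (G (Complex x (-t)))" for x t
    by (simp add: F_def complex_cnj)
  obtain C' c' where "c' > 0" and *: "\<And>x t. x0 \<le> x \<Longrightarrow> -a \<le> t \<Longrightarrow> t \<le> -g \<Longrightarrow>
     norm (F (Complex x t)) \<le> exp (C' - c' * exp (\<rho> * x))"
    by (rule Phragmen_Lindelof_strip_decay[OF F, of "-a" "-g" "-b" K \<rho> \<sigma> c x0 Ca Cb Db C D])
       (use assms in \<open>auto simp: nF\<close>)
  moreover have "norm (G (Complex x t)) \<le> exp (C' - c' * exp (\<rho> * x))" if "x0 \<le> x" "g \<le> t" "t \<le> a" for x t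
    using *[of x "-t"] that by (simp add: nF)
  ultimately show thesis using that by blast
qed

text \<open>Multiplying by \<open>exp (B e\<^sup>s\<^sup>\<zeta>)\<close> with \<open>s = \<pi> / (b - a) < \<rho>\<close> costs nothing on the two edges;
  letting \<open>B\<close> tend to infinity kills the function on the middle line.\<close>

lemma strip_decay_imp_zero:
  assumes G: "G holomorphic_on UNIV" and ab: "a < b" "pi < \<rho> * (b - a)"
    and c: "0 < c"
    and dec: "\<And>x t. x0 \<le> x \<Longrightarrow> a \<le> t \<Longrightarrow> t \<le> b \<Longrightarrow> norm (G (Complex x t)) \<le> exp (C - c * exp (\<rho> * x))"
  shows "G z = 0"
proof -
  \<comment> \<open>With this rate the cosine vanishes exactly on the two edges, where the factor
    then has modulus 1; \<open>s < \<rho>\<close> is just the hypothesis on the width.\<close>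
  define s where "s = pi / (b - a)"
  define m where "m = (a + b) / 2"
  have s: "0 < s" "s < \<rho>" using ab by (auto simp: s_def field_simps)
  have cos0: "0 \<le> cos (s * (t - m))" if "a \<le> t" "t \<le> b" for t
  proof (rule cos_ge_zero)
    have "\<bar>t - m\<bar> \<le> (b - a) / 2" using that by (auto simp: m_def field_simps abs_le_iff)
    then have "\<bar>s * (t - m)\<bar> \<le> s * ((b - a) / 2)" using s by (simp add: abs_mult mult_left_mono)
    also have "\<dots> = pi / 2" using ab by (simp add: s_def)
    finally show "- (pi/2) \<le> s * (t - m)" "s * (t - m) \<le> pi/2" by auto
  qed
  have zero: "G (Complex x m) = 0" if x: "x0 < x" for x
  proof -
    have bd: "norm (G (Complex x m)) \<le> exp C * exp (- B * (exp (s * x) - exp (s * x0)))" if B: "0 < B" for B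
    proof -
      define H where "H = (\<lambda>z. G z * exp (of_real B * exp (of_real s * (z - \<i> * of_real m))))"
      have H: "H holomorphic_on UNIV" unfolding H_def by (intro holomorphic_intros G)
      have nH: "norm (H (Complex x t)) = norm (G (Complex x t)) * exp (B * (exp (s * x) * cos (s * (t - m))))" for x t
        unfolding H_def norm_mult norm_exp_eq_Re using Re_mult_exp_Complex[of s x t m] by simp
      have le: "norm (G (Complex x t)) \<le> exp C" if "x0 \<le> x" "a \<le> t" "t \<le> b" for x t
        using dec[OF that] c by (smt (verit) exp_le_cancel_iff exp_gt_zero mult_pos_pos)
      \<comment> \<open>The cost of the factor is paid on the left edge only. On the middle line at
        x > x0 the factor is larger, and the surplus \<open>B * (exp (s * x) - exp (s * x0))\<close>
        grows with \<open>B\<close>.\<close>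
      define L where "L = exp C * exp (B * exp (s * x0))"
      have L: "exp C \<le> L" using B by (simp add: L_def)
      have cosab: "cos (s * (a - m)) = 0" "cos (s * (b - m)) = 0"
      proof -
        have "s * (b - m) = pi/2" "s * (a - m) = - (pi/2)" using ab by (auto simp: s_def m_def field_simps)
        then show "cos (s * (a - m)) = 0" "cos (s * (b - m)) = 0" by (simp_all only: cos_minus cos_pi_half)
      qed
      obtain B' where B': "\<And>x. B * exp (s * x) \<le> (c/2) * exp (\<rho> * x) + B'"
        using exp_gap[of s \<rho> "c/2" B] s c B by auto
      have "filterlim (\<lambda>y. (c/2) * exp (\<rho> * y)) at_top at_top"
        using c s by (intro filterlim_tendsto_pos_mult_at_top[OF tendsto_const] filterlim_compose[OF exp_at_top] filterlim_ident) auto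
      then have "eventually (\<lambda>y. B' \<le> (c/2) * exp (\<rho> * y)) at_top"
        unfolding filterlim_at_top by blast
      then obtain X where X: "x \<le> X" "B' \<le> (c/2) * exp (\<rho> * X)"
        using eventually_happens'[OF _ eventually_conj[OF _ eventually_ge_at_top[of x]]] by (metis trivial_limit_at_top_linorder)
      have "norm (H (Complex x m)) \<le> L"
      proof (rule maximum_modulus_rectangle[OF H, of x0 X a L b])
        show "norm (H (Complex y a)) \<le> L" if "x0 \<le> y" "y \<le> X" for y
          using le[of y a] that ab L by (simp add: nH cosab)
        show "norm (H (Complex y b)) \<le> L" if "x0 \<le> y" "y \<le> X" for y
          using le[of y b] that ab L by (simp add: nH cosab)
        show "norm (H (Complex x0 t)) \<le> L" if "a \<le> t" "t \<le> b" for t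
          unfolding nH L_def using le[of x0 t] that B
          by (intro mult_mono) (auto intro!: mult_left_le)
        show "norm (H (Complex X t)) \<le> L" if t: "a \<le> t" "t \<le> b" for t
        proof -
          have "norm (H (Complex X t)) \<le> exp (C - c * exp (\<rho> * X)) * exp (B * exp (s * X))"
            unfolding nH using dec[of X t] t X x B
            by (intro mult_mono) (auto intro!: mult_left_le)
          also have "\<dots> = exp (C - c * exp (\<rho> * X) + B * exp (s * X))" by (simp add: exp_add[symmetric])
          also have "\<dots> \<le> exp C" using B'[of X] X by simp
          finally show ?thesis using L by simp
        qed
      qed (use x X ab in \<open>auto simp: m_def\<close>)
      then have "norm (G (Complex x m)) * exp (B * exp (s * x)) \<le> L" by (simp add: nH)
      then have "norm (G (Complex x m)) \<le> L * exp (- (B * exp (s * x)))" by (simp add: exp_minus field_simps)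
      also have "\<dots> = exp C * exp (- B * (exp (s * x) - exp (s * x0)))"
        unfolding L_def by (simp add: exp_add[symmetric] algebra_simps)
      finally show ?thesis .
    qed
    have pos: "0 < exp (s * x) - exp (s * x0)" using s x by simp
    have "((\<lambda>B. exp C * exp (- B * (exp (s * x) - exp (s * x0)))) \<longlongrightarrow> exp C * 0) at_top"
      using pos
      by (intro tendsto_mult tendsto_const filterlim_compose[OF exp_at_bot])
         (auto intro!: filterlim_tendsto_pos_mult_at_bot simp: filterlim_uminus_at_bot filterlim_ident
           intro: filterlim_at_top_mult_tendsto_pos[OF tendsto_const])
    then have "norm (G (Complex x m)) \<le> exp C * 0"
      by (rule tendsto_lowerbound) (use bd in \<open>auto intro!: eventually_mono[OF eventually_gt_at_top[of 0]]\<close>)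
    then show ?thesis by simp
  qed
  show ?thesis
  proof (rule analytic_continuation[OF G, of "(\<lambda>x. Complex x m) ` {x0<..}" "Complex (x0 + 1) m"])
    show "Complex (x0 + 1) m islimpt (\<lambda>x. Complex x m) ` {x0<..}"
      unfolding islimpt_approachable
    proof (intro allI impI)
      fix e :: real assume e: "0 < e"
      have "Complex (x0 + 1 + e/2) m \<in> (\<lambda>x. Complex x m) ` {x0<..}" using e by auto
      moreover have "Complex (x0 + 1 + e/2) m - Complex (x0 + 1) m = of_real (e/2)" by (simp add: complex_eq_iff)
      then have "dist (Complex (x0 + 1 + e/2) m) (Complex (x0 + 1) m) < e" using e unfolding dist_norm by (simp only: norm_of_real)
      ultimately show "\<exists>x'\<in>(\<lambda>x. Complex x m) ` {x0<..}. x' \<noteq> Complex (x0 + 1) m \<and> dist x' (Complex (x0 + 1) m) < e"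
        using e by (intro bexI[of _ "Complex (x0 + 1 + e/2) m"]) auto
    qed
  qed (use zero in auto)
qed

section \<open>Lower bounds for entire functions\<close>

text \<open>A zero-free function satisfies the Borel--Caratheodory estimate, obtained from the Schwarz
  lemma applied to \<open>L / (2 A - L)\<close> with \<open>L\<close> a branch of \<open>log (g / g c)\<close>.\<close>

lemma zero_free_lower_bound:
  assumes g: "g holomorphic_on UNIV" and R: "0 < R"
    and nz: "\<And>z. z \<in> cball c (2 * R) \<Longrightarrow> g z \<noteq> 0"
    and B: "\<And>z. z \<in> cball c (2 * R) \<Longrightarrow> norm (g z) \<le> B"
    and z: "z \<in> cball c R"
  shows "norm (g c) ^ 3 / (exp 2 * B\<^sup>2) \<le> norm (g z)"
proof -
  have hol: "g holomorphic_on ball c (2*R)" using g holomorphic_on_subset by blast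
  have "\<exists>L. L holomorphic_on ball c (2*R) \<and> (\<forall>z \<in> ball c (2*R). g z = exp (L z))"
    using simply_connected_eq_holomorphic_log[OF open_ball, of c "2*R"]
      convex_imp_simply_connected[OF convex_ball, of c "2*R"] hol nz by auto
  then obtain L where L: "L holomorphic_on ball c (2*R)" "\<And>z. z \<in> ball c (2*R) \<Longrightarrow> g z = exp (L z)"
    by blast
  have cin: "c \<in> ball c (2*R)" using R by simp
  have B0: "B > 0" using nz[of c] B[of c] R by (auto intro: less_le_trans[of _ "norm (g c)"])
  have Re_le: "Re (L w) \<le> ln B" if "w \<in> ball c (2*R)" for w
  proof -
    have "exp (Re (L w)) \<le> B" using B[of w] that L(2)[OF that] by (simp add: norm_exp_eq_Re)
    then show ?thesis using B0 by (metis exp_le_cancel_iff exp_ln)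
  qed
  \<comment> \<open>The summand 1 makes the bound \<open>Re (u w) < A\<close> strict and
    \<open>A\<close> positive; it is the origin of \<open>exp 2\<close> in the conclusion.\<close>
  define A where "A = ln B - Re (L c) + 1"
  have A: "A \<ge> 1" using Re_le[OF cin] by (simp add: A_def)
  define u where "u = (\<lambda>w. L (c + of_real (2*R) * w) - L c)"
  have inb: "c + of_real (2*R) * w \<in> ball c (2*R)" if "norm w < 1" for w
    using that R by (simp add: dist_norm norm_mult)
  have Reu: "Re (u w) < A" if "norm w < 1" for w
    using Re_le[OF inb[OF that]] by (simp add: u_def A_def)
  have u: "u holomorphic_on ball 0 1" unfolding u_def
    by (intro holomorphic_intros holomorphic_on_compose_gen[OF _ L(1), unfolded o_def]) (auto intro: inb simp del: mem_ball of_real_mult)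
  have u0: "u 0 = 0" by (simp add: u_def)
  \<comment> \<open>Points of real part below \<open>A\<close> lie nearer to 0 than to 2A, so \<phi>
    maps the unit disc into itself. The closed disc of radius \<open>R\<close> about
    \<open>c\<close> corresponds to |w| <= 1/2, where Schwarz gives |\<phi> w| <= 1/2, and solving
    for \<open>u w\<close> yields |u w| <= 2A.\<close>
  define \<phi> where "\<phi> = (\<lambda>w. u w / (2 * of_real A - u w))"
  have den: "2 * of_real A - u w \<noteq> 0" "norm (u w) < norm (2 * of_real A - u w)" if w: "norm w < 1" for w
  proof -
    have "(norm (u w))\<^sup>2 < (norm (2 * of_real A - u w))\<^sup>2"
      using Reu[OF w] A unfolding cmod_power2 by (simp add: power2_eq_square algebra_simps)
    then show "norm (u w) < norm (2 * of_real A - u w)" by (rule power_less_imp_less_base) simp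
    then show "2 * of_real A - u w \<noteq> 0" by auto
  qed
  have phi_hol: "\<phi> holomorphic_on ball 0 1" unfolding \<phi>_def
    by (intro holomorphic_intros u) (use den in auto)
  have phi_le: "norm (\<phi> w) < 1" if "norm w < 1" for w
    unfolding \<phi>_def norm_divide using den[OF that] by (auto simp: divide_less_eq_1)
  define w where "w = (z - c) / of_real (2*R)"
  have w: "norm w \<le> 1/2" using z R by (simp add: w_def norm_divide dist_norm norm_minus_commute field_simps)
  have zw: "z = c + of_real (2*R) * w" using R by (simp add: w_def)
  have "norm (\<phi> w) \<le> norm w"
    by (rule Schwarz_Lemma(1)[OF phi_hol _ phi_le]) (use w in \<open>auto simp: \<phi>_def u0\<close>)
  then have pw: "norm (\<phi> w) \<le> 1/2" using w by simp
  have "u w = \<phi> w * (2 * of_real A - u w)" using den(1)[of w] w by (simp add: \<phi>_def)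
  then have "norm (u w) = norm (\<phi> w) * norm (2 * of_real A - u w)" by (metis norm_mult)
  also have "\<dots> \<le> 1/2 * (2 * A + norm (u w))"
    using pw norm_triangle_ineq4[of "2 * of_real A" "u w"] A by (intro mult_mono) auto
  finally have "norm (u w) \<le> 2 * A" by simp
  then have "- (2 * A) \<le> Re (u w)" using abs_Re_le_cmod[of "u w"] by linarith
  then have Lz: "3 * Re (L c) - 2 * ln B - 2 \<le> Re (L z)" using zw by (simp add: u_def A_def algebra_simps)
  have zin: "z \<in> ball c (2*R)" using z R by auto
  have "norm (g c) ^ 3 / (exp 2 * B\<^sup>2) = exp (3 * Re (L c) - 2 * ln B - 2)"
  proof -
    have "exp (3 * Re (L c) - 2 * ln B - 2) = exp (Re (L c)) ^ 3 / (exp (ln B) ^ 2 * exp 2)"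
      by (simp add: exp_diff exp_of_nat_mult[symmetric])
    then show ?thesis using B0 L(2)[OF cin] by (simp add: norm_exp_eq_Re mult.commute)
  qed
  also have "\<dots> \<le> norm (g z)" using Lz L(2)[OF zin] by (simp add: norm_exp_eq_Re)
  finally show ?thesis .
qed

lemma norm_prod_list: "norm (prod_list (map f xs)) = prod_list (map (\<lambda>x. norm (f x)) xs)"
  for f :: "'a \<Rightarrow> complex"
  by (induction xs) (auto simp: norm_mult)

lemma prod_list_lower:
  fixes f :: "'a \<Rightarrow> real"
  assumes "\<And>x. x \<in> set xs \<Longrightarrow> l \<le> f x" "0 \<le> l"
  shows "l ^ length xs \<le> prod_list (map f xs)"
  using assms(1)
proof (induction xs)
  case (Cons a xs)
  then have "l * l ^ length xs \<le> f a * prod_list (map f xs)"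
    using assms(2) by (intro mult_mono) (auto intro: order_trans[of 0 l])
  then show ?case by simp
qed simp

lemma prod_list_upper:
  fixes f :: "'a \<Rightarrow> real"
  assumes "\<And>x. x \<in> set xs \<Longrightarrow> 0 \<le> f x \<and> f x \<le> u"
  shows "0 \<le> prod_list (map f xs) \<and> prod_list (map f xs) \<le> u ^ length xs"
  using assms
proof (induction xs)
  case (Cons a xs)
  then have "0 \<le> f a" "f a \<le> u" "0 \<le> prod_list (map f xs)" "prod_list (map f xs) \<le> u ^ length xs" by auto
  moreover from this have "f a * prod_list (map f xs) \<le> u * u ^ length xs" by (intro mult_mono) auto
  ultimately show ?case by simp
qed simp

text \<open>The zeros in the disc of radius \<open>2 * R\<close> are divided out one at a time. On
  the sphere of radius \<open>6 * R\<close> each linear factor is at least \<open>4 * R\<close>, at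
  the centre at most \<open>2 * R\<close>, so every zero costs a factor 2 between |h c| and
  \<open>M\<close>. This Jensen-type count bounds the length of a factorization, and one of maximal
  length leaves a cofactor without zeros in the disc.\<close>

lemma zero_factorization:
  assumes h: "h holomorphic_on UNIV" and hc: "h c \<noteq> 0" and R: "1 \<le> R"
    and M: "\<And>z. z \<in> sphere c (6 * R) \<Longrightarrow> norm (h z) \<le> M"
  obtains xs g where "g holomorphic_on UNIV" "\<And>z. h z = (\<Prod>a\<leftarrow>xs. z - a) * g z"
    "\<And>z. z \<in> cball c (2 * R) \<Longrightarrow> g z \<noteq> 0 \<and> norm (g z) \<le> M"
    "2 ^ length xs \<le> M / norm (h c)" "norm (h c) / (2 * R) ^ length xs \<le> norm (g c)"
proof -
  define P where "P = (\<lambda>xs g. g holomorphic_on UNIV \<and> set xs \<subseteq> cball c (2*R) \<and> (\<forall>z. h z = (\<Prod>a\<leftarrow>xs. z - a) * g z))"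
  have gM: "norm (g z) \<le> M / (4*R) ^ length xs" if P: "P xs g" and z: "z \<in> cball c (6*R)" for xs g z
  proof (rule maximum_modulus_frontier[of g "cball c (6*R)"])
    show "g holomorphic_on interior (cball c (6*R))" using P P_def holomorphic_on_subset by blast
    show "continuous_on (closure (cball c (6*R))) g" using P P_def holomorphic_on_imp_continuous_on continuous_on_subset by blast
    fix w assume "w \<in> frontier (cball c (6*R))"
    then have w: "w \<in> sphere c (6*R)" using R by (simp add: frontier_cball)
    have "(4*R) ^ length xs \<le> norm (\<Prod>a\<leftarrow>xs. w - a)"
      unfolding norm_prod_list
    proof (rule prod_list_lower)
      fix a assume "a \<in> set xs"
      then have "dist c a \<le> 2 * R" using P by (auto simp: P_def)
      moreover have "dist c w = 6 * R" using w by simp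
      ultimately have "4 * R \<le> dist w a" using dist_triangle[of c w a] by (simp add: dist_commute)
      then show "4 * R \<le> norm (w - a)" by (simp add: dist_norm)
    qed (use R in simp)
    then have "(4*R) ^ length xs * norm (g w) \<le> norm (\<Prod>a\<leftarrow>xs. w - a) * norm (g w)" by (intro mult_right_mono) auto
    also have "\<dots> = norm (h w)" using P by (simp add: P_def norm_mult)
    also have "\<dots> \<le> M" using M w by simp
    finally show "norm (g w) \<le> M / (4*R) ^ length xs" using R by (simp add: field_simps)
  qed (use z in auto)
  have hcg: "norm (h c) \<le> (2*R) ^ length xs * norm (g c)" if P: "P xs g" for xs g
  proof -
    have "norm (h c) = norm (\<Prod>a\<leftarrow>xs. c - a) * norm (g c)" using P by (simp add: P_def norm_mult)
    also have "norm (\<Prod>a\<leftarrow>xs. c - a) \<le> (2*R) ^ length xs" unfolding norm_prod_list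
      by (rule conjunct2[OF prod_list_upper]) (use P in \<open>auto simp: P_def dist_norm\<close>)
    finally show ?thesis by (simp add: mult_right_mono)
  qed
  have len: "2 ^ length xs \<le> M / norm (h c)" if P: "P xs g" for xs g
  proof -
    have "norm (g c) \<le> M / (4*R) ^ length xs" by (rule gM[OF P]) (use R in simp)
    then have "(2*R) ^ length xs * norm (g c) \<le> (2*R) ^ length xs * (M / (4*R) ^ length xs)"
      using R by (intro mult_left_mono) auto
    with hcg[OF P] have "norm (h c) \<le> (2*R) ^ length xs * (M / (4*R) ^ length xs)" by (rule order_trans)
    also have "\<dots> = M / 2 ^ length xs"
    proof -
      have "(4*R) ^ length xs = 2 ^ length xs * (2*R) ^ length xs" by (simp only: power_mult_distrib[symmetric]) simp
      moreover have "(2*R) ^ length xs \<noteq> 0" using R by simp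
      moreover have "X * (M / (Y * X)) = M / Y" if "X \<noteq> 0" for X Y using that by simp
      ultimately show ?thesis by (simp only:)
    qed
    finally have *: "norm (h c) \<le> M / 2 ^ length xs" .
    have "0 < norm (h c)" using hc by simp
    then show ?thesis using * by (simp only: pos_le_divide_eq zero_less_power zero_less_numeral mult.commute)
  qed
  define S where "S = {length xs | xs. \<exists>g. P xs g}"
  have "finite S"
  proof (rule finite_subset)
    show "S \<subseteq> {..nat \<lceil>M / norm (h c)\<rceil>}"
    proof
      fix k assume "k \<in> S"
      then have "2 ^ k \<le> M / norm (h c)" using len S_def by auto
      moreover have "real k \<le> 2 ^ k" using of_nat_less_two_power[of k] by (simp add: less_imp_le)
      ultimately have "real k \<le> real_of_int \<lceil>M / norm (h c)\<rceil>" by linarith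
      then show "k \<in> {..nat \<lceil>M / norm (h c)\<rceil>}" by (simp add: le_nat_iff)
    qed
  qed simp
  moreover have "P [] h" by (simp add: P_def h)
  then have "0 \<in> S" using S_def by force
  ultimately have "Max S \<in> S" "\<And>k. k \<in> S \<Longrightarrow> k \<le> Max S" using Max_in by auto
  then obtain xs g where P: "P xs g" and mx: "\<And>ys f. P ys f \<Longrightarrow> length ys \<le> length xs"
    unfolding S_def by force
  have nz: "g a \<noteq> 0" if a: "a \<in> cball c (2*R)" for a
  proof
    assume ga: "g a = 0"
    define f where "f = (\<lambda>z. if z = a then deriv g a else (g z - g a)/(z-a))"
    have "f holomorphic_on UNIV" unfolding f_def by (rule pole_lemma_open) (use P P_def in auto)
    moreover have "g z = (z - a) * f z" for z using ga by (auto simp: f_def)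
    ultimately have "P (a # xs) f" using P a by (auto simp: P_def)
    then show False using mx by fastforce
  qed
  show thesis
  proof (rule that[of g xs])
    show "norm (h c) / (2*R) ^ length xs \<le> norm (g c)" using hcg[OF P] R by (simp add: field_simps)
    have M0: "0 \<le> M" using len[OF P] hc by (smt (verit) divide_nonpos_pos zero_less_norm_iff zero_less_power)
    have "1 \<le> (4*R) ^ length xs" using R by (intro one_le_power) simp
    then have "M / (4*R) ^ length xs \<le> M / 1" using M0 by (intro divide_left_mono) auto
    then have "M / (4*R) ^ length xs \<le> M" by simp
    then show "g z \<noteq> 0 \<and> norm (g z) \<le> M" if "z \<in> cball c (2*R)" for z
      using nz[OF that] gM[OF P, of z] that R by auto
  qed (use P P_def len in auto)
qed

text \<open>Pigeonhole: the candidates \<open>(2 * i + 1) * l\<close> with i <= N are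
  \<open>2 * l\<close> apart, so each of the N points comes closer than \<open>l\<close> to at most
  one of the N + 1 candidates.\<close>

lemma avoid_points:
  fixes ds :: "real list"
  assumes "0 < \<eta>"
  obtains t where "0 < t" "t < \<eta>" "\<And>d. d \<in> set ds \<Longrightarrow> \<eta> / (2 * (real (length ds) + 1)) \<le> \<bar>t - d\<bar>"
proof -
  define N where "N = length ds"
  define l where "l = \<eta> / (2 * (real N + 1))"
  have l: "l > 0" "2 * (real N + 1) * l = \<eta>" using assms by (auto simp: l_def field_simps add_eq_0_iff2)
  define t where "t = (\<lambda>i. (2 * real i + 1) * l)"
  have "\<exists>i\<in>{..N}. \<forall>d\<in>set ds. l \<le> \<bar>t i - d\<bar>"
  proof (rule ccontr)
    assume "\<not> ?thesis"
    then have "\<forall>i\<in>{..N}. \<exists>d\<in>set ds. \<bar>t i - d\<bar> < l" by (auto simp: not_le)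
    then obtain F where F: "\<And>i. i \<le> N \<Longrightarrow> F i \<in> set ds \<and> \<bar>t i - F i\<bar> < l" by (metis atMost_iff)
    have "card (set ds) < card {..N}" using card_length[of ds] by (simp add: N_def)
    then have "\<not> inj_on F {..N}" using card_inj_on_le[of F "{..N}" "set ds"] F by auto
    then obtain i j where ij: "i \<le> N" "j \<le> N" "F i = F j" "i \<noteq> j" by (auto simp: inj_on_def)
    have "1 \<le> \<bar>real i - real j\<bar>" using ij by (cases "i < j") auto
    then have "2 * l * 1 \<le> 2 * l * \<bar>real i - real j\<bar>" using l by (intro mult_left_mono) auto
    also have "\<dots> = \<bar>t i - t j\<bar>"
    proof -
      have "t i - t j = (2 * l) * (real i - real j)" by (simp add: t_def algebra_simps)
      then show ?thesis using l by (simp only: abs_mult abs_of_pos mult_pos_pos zero_less_numeral)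
    qed
    finally show False using F[of i] F[of j] ij by auto
  qed
  then obtain i where i: "i \<le> N" "\<forall>d\<in>set ds. l \<le> \<bar>t i - d\<bar>" by auto
  have "t i < \<eta>"
  proof -
    have "(2 * real i + 1) * l < 2 * (real N + 1) * l" using i l by (intro mult_strict_right_mono) auto
    then show ?thesis using l(2) unfolding t_def by linarith
  qed
  moreover have "0 < t i" using l by (simp add: t_def)
  ultimately show thesis using that i by (simp add: l_def N_def)
qed

text \<open>A radius kept away from the distances of \<open>z\<close> to the zeros keeps every
  linear factor away from 0 on the whole circle, by the triangle inequality. The zero-free cofactor
  is left to \<open>zero_free_lower_bound\<close>.\<close>

lemma lower_bound_on_circle:
  assumes h: "h holomorphic_on UNIV" and hc: "h c \<noteq> 0" and R: "1 \<le> R"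
    and M: "\<And>z. z \<in> sphere c (6 * R) \<Longrightarrow> norm (h z) \<le> M"
    and \<eta>: "0 < \<eta>" "\<eta> \<le> 1" and z: "dist c z + 1 \<le> R"
  obtains t N where "0 < t" "t < \<eta>" "2 ^ N \<le> M / norm (h c)"
    "\<And>w. dist z w = t \<Longrightarrow> (\<eta> / (2 * (real N + 1))) ^ N * ((norm (h c) / (2*R) ^ N) ^ 3 / (exp 2 * M\<^sup>2)) \<le> norm (h w)"
proof -
  obtain xs g where g: "g holomorphic_on UNIV" and hg: "\<And>z. h z = (\<Prod>a\<leftarrow>xs. z - a) * g z"
    and gz: "\<And>z. z \<in> cball c (2 * R) \<Longrightarrow> g z \<noteq> 0 \<and> norm (g z) \<le> M"
    and len: "2 ^ length xs \<le> M / norm (h c)" and gc: "norm (h c) / (2 * R) ^ length xs \<le> norm (g c)"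
    using zero_factorization[OF h hc R M] by metis
  define N where "N = length xs"
  obtain t where t: "0 < t" "t < \<eta>" and av: "\<And>d. d \<in> set (map (dist z) xs) \<Longrightarrow> \<eta> / (2 * (real N + 1)) \<le> \<bar>t - d\<bar>"
    using avoid_points[OF \<eta>(1), of "map (dist z) xs"] by (auto simp: N_def)
  have "(\<eta> / (2 * (real N + 1))) ^ N * ((norm (h c) / (2*R) ^ N) ^ 3 / (exp 2 * M\<^sup>2)) \<le> norm (h w)" if w: "dist z w = t" for w
  proof -
    have "(\<eta> / (2 * (real N + 1))) ^ N \<le> norm (\<Prod>a\<leftarrow>xs. w - a)"
      unfolding norm_prod_list N_def
    proof (rule prod_list_lower)
      fix a assume "a \<in> set xs"
      then have "\<eta> / (2 * (real N + 1)) \<le> \<bar>dist z w - dist z a\<bar>" using av w by auto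
      also have "\<dots> \<le> dist w a" using dist_triangle[of z w a] dist_triangle[of z a w] by (simp add: dist_commute abs_le_iff)
      finally show "\<eta> / (2 * (real (length xs) + 1)) \<le> norm (w - a)" by (simp add: dist_norm N_def)
    qed (use \<eta> in simp)
    moreover have "(norm (h c) / (2*R) ^ N) ^ 3 / (exp 2 * M\<^sup>2) \<le> norm (g w)"
    proof -
      have "dist c w \<le> R" using z dist_triangle[of c w z] w t \<eta> by (simp add: dist_commute)
      then have "norm (g c) ^ 3 / (exp 2 * M\<^sup>2) \<le> norm (g w)"
        by (intro zero_free_lower_bound[OF g, of R c M w]) (use gz R in auto)
      moreover have "(norm (h c) / (2*R) ^ N) ^ 3 \<le> norm (g c) ^ 3"
        using gc R by (intro power_mono) (auto simp: N_def)
      ultimately show ?thesis by (meson divide_right_mono exp_ge_zero mult_nonneg_nonneg order_trans zero_le_power2)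
    qed
    ultimately show ?thesis unfolding hg norm_mult using R \<eta> by (intro mult_mono) auto
  qed
  then show thesis using that t len N_def by blast
qed

section \<open>Sectors where the exponential factor is large\<close>

text \<open>There are O(r^\<alpha>) zeros to avoid, and each costs a power of r, so the loss in the
  exponent is O(r^\<alpha> log r), which is negligible against r^\<nu>. Requiring a radius below
  \<open>r powr - \<kappa>\<close> costs only one more logarithm per zero, so \<kappa> is
  arbitrary.\<close>

lemma lower_bound_on_small_circles:
  assumes h: "h holomorphic_on UNIV" and nz: "h c \<noteq> 0"
    and bd: "\<And>z. R0 \<le> norm z \<Longrightarrow> norm (h z) \<le> exp (norm z powr \<alpha>)"
    and \<alpha>: "0 < \<alpha>" "\<alpha> < \<nu>" and \<kappa>: "0 \<le> \<kappa>" and \<epsilon>: "0 < \<epsilon>"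
  shows "\<forall>\<^sub>F r in at_top. \<forall>z. norm z \<le> r \<longrightarrow>
    (\<exists>t. 0 < t \<and> t < r powr - \<kappa> \<and> (\<forall>w. dist z w = t \<longrightarrow> exp (- \<epsilon> * r powr \<nu>) \<le> norm (h w)))"
proof -
  define l where "l = \<bar>ln (norm (h c))\<bar>"
  \<comment> \<open>\<open>C * r powr \<alpha>\<close> will bound the number of zeros: the count on
    the disc of radius \<open>2 * (2 * r)\<close> uses the sphere of radius \<open>12 * r\<close>
    about \<open>c\<close>, which lies within norm \<open>13 * r\<close>. The factor 2 comes from
    \<open>ln 2 \<ge> 1/2\<close>.\<close>
  define C where "C = 2 * (13 powr \<alpha> + l)"
  have l0: "0 \<le> l" by (simp add: l_def)
  have C0: "0 < C" using l0 by (simp add: C_def add_pos_nonneg)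
  have "\<forall>\<^sub>F r in at_top. C * r powr \<alpha> * (\<kappa> * ln r + ln (2 * (C * r powr \<alpha> + 1)) + 3 * ln (4 * r)) + 3 * l + 2 + 2 * (13 * r) powr \<alpha> \<le> \<epsilon> * r powr \<nu>"
    using \<alpha> \<epsilon> C0 by real_asymp
  moreover have "\<forall>\<^sub>F r in at_top. r \<ge> max R0 (norm c + 1)" by (rule eventually_ge_at_top)
  ultimately show ?thesis
  proof eventually_elim
    case (elim r)
    have r: "r \<ge> R0" "r \<ge> norm c + 1" "r \<ge> 1" "r > 0" using elim norm_ge_zero[of c] by linarith+
    show ?case
    proof (intro allI impI)
      fix z :: complex assume z: "norm z \<le> r"
      define M where "M = exp ((13 * r) powr \<alpha>)"
      have M: "norm (h w) \<le> M" if "w \<in> sphere c (6 * (2 * r))" for w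
      proof -
        have "norm (w - c) = 12 * r" using that by (simp add: dist_norm norm_minus_commute)
        then have "norm w \<le> 13 * r" "r \<le> norm w"
          using norm_triangle_ineq[of "w - c" c] norm_triangle_ineq2[of "w - c" "-c"] r by simp_all
        then have "norm w powr \<alpha> \<le> (13 * r) powr \<alpha>" "R0 \<le> norm w" using r \<alpha> by (auto intro!: powr_mono2)
        then show ?thesis using bd[of w] by (simp add: M_def order_trans)
      qed
      define \<eta> where "\<eta> = r powr - \<kappa>"
      have \<eta>: "0 < \<eta>" "\<eta> \<le> 1" using r \<kappa> by (auto simp: \<eta>_def powr_minus inverse_le_1_iff ge_one_powr_ge_zero)
      have dz: "dist c z + 1 \<le> 2 * r" using z r norm_triangle_ineq4[of c z] by (simp add: dist_norm)
      obtain t N where t: "0 < t" "t < \<eta>" and N: "2 ^ N \<le> M / norm (h c)"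
        and low: "\<And>w. dist z w = t \<Longrightarrow> (\<eta> / (2 * (real N + 1))) ^ N * ((norm (h c) / (2*(2*r)) ^ N) ^ 3 / (exp 2 * M\<^sup>2)) \<le> norm (h w)"
        using lower_bound_on_circle[OF h nz _ M \<eta> dz] r by auto
      have hc0: "0 < norm (h c)" using nz by simp
      have ln_r: "0 \<le> ln r" using r by simp
      have ra: "1 \<le> r powr \<alpha>" using r \<alpha> by (simp add: ge_one_powr_ge_zero)
      have N1: "real N \<le> C * r powr \<alpha>"
      proof -
        have "real N * ln 2 \<le> ln (M / norm (h c))" using N hc0
          by (metis (no_types, lifting) ln_le_cancel_iff ln_realpow zero_less_numeral zero_less_power order_less_le_trans)
        also have "\<dots> \<le> (13 * r) powr \<alpha> + l" using hc0 by (simp add: ln_div M_def l_def)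
        also have "\<dots> \<le> 13 powr \<alpha> * r powr \<alpha> + l * r powr \<alpha>" using r ra l0
          by (simp add: powr_mult mult_le_cancel_left1)
        finally have "real N * ln 2 \<le> C/2 * r powr \<alpha>" by (simp add: C_def algebra_simps)
        moreover have "real N * (1/2) \<le> real N * ln 2" using ln2_ge_two_thirds by (intro mult_left_mono) auto
        ultimately show ?thesis by simp
      qed
      \<comment> \<open>The logarithm of the bound from \<open>lower_bound_on_circle\<close>. The
        asymptotic inequality fixed at the start majorises -E, with N replaced by its bound.\<close>
      define E where "E = real N * (ln \<eta> - ln (2 * (real N + 1))) + 3 * (ln (norm (h c)) - real N * ln (4 * r)) - 2 - 2 * (13 * r) powr \<alpha>"
      have eqE: "(\<eta> / (2 * (real N + 1))) ^ N * ((norm (h c) / (2*(2*r)) ^ N) ^ 3 / (exp 2 * M\<^sup>2)) = exp E"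
      proof -
        have 1: "(\<eta> / (2 * (real N + 1))) ^ N = exp (real N * (ln \<eta> - ln (2 * (real N + 1))))"
          using \<eta> by (simp add: exp_of_nat_mult exp_diff)
        have 2: "(norm (h c) / (2*(2*r)) ^ N) ^ 3 = exp (3 * (ln (norm (h c)) - real N * ln (4 * r)))"
          using exp_of_nat_mult[of 3 "ln (norm (h c)) - real N * ln (4 * r)"] r hc0 by (simp add: exp_of_nat_mult exp_diff)
        have 3: "M\<^sup>2 = exp (2 * (13 * r) powr \<alpha>)" by (simp add: M_def exp_double)
        show ?thesis unfolding 1 2 3 E_def by (simp add: exp_diff exp_add algebra_simps)
      qed
      have "- \<epsilon> * r powr \<nu> \<le> E"
      proof -
        have ln1: "ln \<eta> = - \<kappa> * ln r" using r by (simp add: \<eta>_def ln_powr)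
        have "real N * (\<kappa> * ln r + ln (2 * (real N + 1)) + 3 * ln (4 * r)) \<le>
           C * r powr \<alpha> * (\<kappa> * ln r + ln (2 * (C * r powr \<alpha> + 1)) + 3 * ln (4 * r))"
          using N1 r C0 ln_r \<kappa> by (intro mult_mono add_mono add_nonneg_nonneg mult_nonneg_nonneg) auto
        moreover have "- l \<le> ln (norm (h c))" by (simp add: l_def)
        ultimately show ?thesis using elim(1) unfolding E_def ln1 by (simp add: algebra_simps)
      qed
      then show "\<exists>t. 0 < t \<and> t < r powr - \<kappa> \<and> (\<forall>w. dist z w = t \<longrightarrow> exp (- \<epsilon> * r powr \<nu>) \<le> norm (h w))"
      proof (intro exI[of _ t] conjI allI impI)
        fix w assume "dist z w = t"
        then have "exp E \<le> norm (h w)" using low unfolding eqE by blast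
        then show "exp (- \<epsilon> * r powr \<nu>) \<le> norm (h w)"
          using \<open>- \<epsilon> * r powr \<nu> \<le> E\<close> by (smt (verit) exp_le_cancel_iff)
      qed (use t in \<open>auto simp: \<eta>_def\<close>)
    qed
  qed
qed

text \<open>Where \<open>A\<close> is huge, the equation reads \<open>f' = - (f'' + q f) / A\<close>. Each use of it on a
  slightly smaller disc gains a factor \<open>4\<close>, the zeros of \<open>A\<close> being circumvented by the maximum
  principle.\<close>

lemma deriv_bound_by_iteration:
  assumes f: "f holomorphic_on UNIV"
    and ode: "\<And>z. deriv (deriv f) z + A z * deriv f z + q z * f z = 0"
    and N: "1 \<le> N"
    and circ: "\<And>z. z \<in> cball z0 1 \<Longrightarrow> \<exists>t. 0 < t \<and> t < 1 / (2 * real N) \<and> (\<forall>w \<in> cball z0 1. dist z w = t \<longrightarrow> L \<le> norm (A w))"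
    and q: "\<And>w. w \<in> cball z0 1 \<Longrightarrow> norm (q w) \<le> Q"
    and L: "4 * (2 * real N + Q) \<le> L"
    and start: "\<And>w. w \<in> cball z0 1 \<Longrightarrow> norm (deriv f w) \<le> 4 ^ N"
  shows "norm (deriv f z0) \<le> 1 + norm (f z0)"
proof -
  define F where "F = norm (f z0)"
  have Q0: "0 \<le> Q" using q[of z0] by (auto intro: order_trans[OF norm_ge_zero])
  have f': "deriv f holomorphic_on UNIV" using f by (rule holomorphic_deriv) simp
  \<comment> \<open>The value \<open>F\<close> at the fixed centre controls \<open>f\<close> on the
    disc up to the current bound for \<open>f'\<close>, so it survives as an additive constant while
    the part \<open>4 ^ (N - k)\<close> shrinks down to 1.\<close>
  have key: "k \<le> N \<Longrightarrow> \<forall>z \<in> cball z0 (1 - real k / real N). norm (deriv f z) \<le> 4 ^ (N - k) + F" for k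
  proof (induction k)
    case 0
    then show ?case using start by (auto simp: F_def intro: add_increasing2)
  next
    case (Suc k)
    define r where "r = 1 - real k / real N"
    define m where "m = 4 ^ (N - k) + F"
    \<comment> \<open>Half of the shrinkage of one stage: one \<open>e\<close> is spent on reaching
      the circle about \<open>z\<close>, the other on Cauchy's estimate for \<open>f''\<close> on
      that circle.\<close>
    define e where "e = 1 / (2 * real N)"
    have e: "e > 0" using N by (simp add: e_def)
    have m: "norm (deriv f z) \<le> m" if "z \<in> cball z0 r" for z
      using Suc that by (auto simp: r_def m_def)
    have r1: "r \<le> 1" by (simp add: r_def)
    have rk: "1 - real (Suc k) / real N = r - 2 * e" using N by (simp add: r_def e_def field_simps)
    have m0: "0 \<le> m" by (simp add: m_def F_def)
    show ?case
    proof
      fix z assume "z \<in> cball z0 (1 - real (Suc k) / real N)"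
      then have z: "dist z0 z \<le> r - 2 * e" by (simp only: rk mem_cball)
      then have z1: "z \<in> cball z0 1" using r1 e by simp
      obtain t where t: "0 < t" "t < e" "\<And>w. w \<in> cball z0 1 \<Longrightarrow> dist z w = t \<Longrightarrow> L \<le> norm (A w)"
        using circ[OF z1] unfolding e_def by blast
      have on_circ: "norm (deriv f w) \<le> 4 ^ (N - Suc k) + F" if w: "dist z w = t" for w
      proof -
        have wr: "dist z0 w \<le> r - e" using dist_triangle[of z0 w z] z w t by (simp add: dist_commute)
        have sub: "cball w e \<subseteq> cball z0 r"
        proof
          fix u assume "u \<in> cball w e"
          then show "u \<in> cball z0 r" using dist_triangle[of z0 u w] wr by simp
        qed
        have f'': "norm (deriv (deriv f) w) \<le> 2 * real N * m"
        proof -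
          have "norm ((deriv ^^ 1) (deriv f) w) \<le> fact 1 * m / e ^ 1"
          proof (rule Cauchy_inequality[OF _ _ e])
            show "deriv f holomorphic_on ball w e" using f' holomorphic_on_subset by blast
            show "continuous_on (cball w e) (deriv f)"
              using holomorphic_on_imp_continuous_on[OF f'] continuous_on_subset by blast
            fix x assume "norm (w - x) = e"
            then have "x \<in> cball w e" by (simp add: dist_norm)
            then show "norm (deriv f x) \<le> m" using m sub by blast
          qed
          then show ?thesis using N by (simp add: e_def field_simps)
        qed
        have win: "w \<in> cball z0 r" "w \<in> cball z0 1" using wr e r1 by auto
        have "norm (f w - f z0) \<le> m * norm (w - z0)"
        proof (rule field_differentiable_bound[of "cball z0 r"])
          show "(f has_field_derivative deriv f u) (at u within cball z0 r)" if "u \<in> cball z0 r" for u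
            using f by (meson DERIV_subset UNIV_I holomorphic_derivI open_UNIV subset_UNIV)
          have "0 \<le> r" using wr e zero_le_dist[of z0 w] by linarith
          then show "z0 \<in> cball z0 r" by simp
        qed (use m win in auto)
        also have "\<dots> \<le> m * 1" using win m0 by (intro mult_left_mono) (auto simp: dist_norm norm_minus_commute)
        finally have fw: "norm (f w) \<le> F + m" using norm_triangle_sub[of "f w" "f z0"] by (simp add: F_def)
        have "A w * deriv f w = - (deriv (deriv f) w + q w * f w)"
          using ode[of w] by (simp add: add_eq_0_iff algebra_simps)
        then have "norm (A w) * norm (deriv f w) = norm (deriv (deriv f) w + q w * f w)"
          by (metis norm_minus_cancel norm_mult)
        also have "\<dots> \<le> 2 * real N * m + Q * (F + m)"
          by (intro order_trans[OF norm_triangle_ineq] add_mono f'')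
             (use q[OF win(2)] fw Q0 in \<open>auto simp: norm_mult intro!: mult_mono\<close>)
        also have "\<dots> \<le> (2 * real N + Q) * (F + m)" by (simp add: algebra_simps F_def)
        finally have "4 * (norm (A w) * norm (deriv f w)) \<le> 4 * ((2 * real N + Q) * (F + m))"
          by (intro mult_left_mono) auto
        then have "4 * (norm (A w) * norm (deriv f w)) \<le> 4 * (2 * real N + Q) * (F + m)" by (simp only: mult.assoc)
        also have "\<dots> \<le> L * (F + m)" using L m0 by (intro mult_right_mono) (auto simp: F_def)
        also have "\<dots> \<le> norm (A w) * (F + m)" using t(3)[OF win(2) w] m0 by (intro mult_right_mono) (auto simp: F_def)
        finally have "norm (A w) * (4 * norm (deriv f w)) \<le> norm (A w) * (F + m)" by simp
        moreover have "0 < norm (A w)" using t(3)[OF win(2) w] L N Q0 by (auto intro: less_le_trans[of _ L])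
        ultimately have "4 * norm (deriv f w) \<le> F + m" by (simp only: mult_le_cancel_left_pos)
        moreover have "N - k = Suc (N - Suc k)" using Suc.prems by simp
        then have "(4::real) ^ (N - k) = 4 * 4 ^ (N - Suc k)" by (simp only: power_Suc)
        moreover have "0 \<le> F" by (simp add: F_def)
        ultimately show ?thesis unfolding m_def by linarith
      qed
      show "norm (deriv f z) \<le> 4 ^ (N - Suc k) + F"
      proof (rule maximum_modulus_frontier[of "deriv f" "cball z t"])
        show "deriv f holomorphic_on interior (cball z t)" using f' holomorphic_on_subset by blast
        show "continuous_on (closure (cball z t)) (deriv f)"
          using holomorphic_on_imp_continuous_on[OF f'] continuous_on_subset by blast
        show "norm (deriv f w) \<le> 4 ^ (N - Suc k) + F" if "w \<in> frontier (cball z t)" for w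
          using on_circ that t(1) by (simp add: frontier_cball)
      qed (use t in auto)
    qed
  qed
  show ?thesis using key[of N] N by (simp add: F_def)
qed

lemma deriv_bound_finite_order:
  assumes f: "f holomorphic_on UNIV"
    and bd: "\<And>z. R0 \<le> norm z \<Longrightarrow> norm (f z) \<le> exp (norm z powr K)" and K: "0 \<le> K"
    and z: "R0 + 1 \<le> norm z"
  shows "norm (deriv f z) \<le> exp ((norm z + 1) powr K)"
proof -
  have "norm ((deriv ^^ 1) f z) \<le> fact 1 * exp ((norm z + 1) powr K) / 1 ^ 1"
  proof (rule Cauchy_inequality)
    show "f holomorphic_on ball z 1" using f holomorphic_on_subset by blast
    show "continuous_on (cball z 1) f" using holomorphic_on_imp_continuous_on[OF f] continuous_on_subset by blast
    fix w assume w: "norm (z - w) = 1"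
    have "R0 \<le> norm w" "norm w \<le> norm z + 1"
      using norm_triangle_ineq2[of z w] norm_triangle_ineq2[of w z] w z by (auto simp: norm_minus_commute)
    then show "norm (f w) \<le> exp ((norm z + 1) powr K)"
      using bd[of w] K by (auto intro!: order_trans[OF bd[of w]] powr_mono2)
  qed simp
  then show ?thesis by simp
qed

text \<open>Chooses the parameters of the iteration. N of size \<open>(r + 2) powr K\<close> brings
  the a priori bound for \<open>f'\<close> below \<open>4 ^ N\<close>; the losses per stage are then
  powers of r, which the lower bound \<open>exp (c/2 * r powr \<nu>)\<close> for the coefficient
  dominates.\<close>

lemma deriv_bound_where_exponent_positive:
  assumes f: "f holomorphic_on UNIV"
    and ode: "\<And>z. deriv (deriv f) z + h z * exp (P z) * deriv f z + q z * f z = 0"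
    and fK: "\<And>z. R0 \<le> norm z \<Longrightarrow> norm (f z) \<le> exp (norm z powr K)" and K: "0 < K"
    and h: "h holomorphic_on UNIV" "h c0 \<noteq> 0"
    and h\<alpha>: "\<And>z. R0 \<le> norm z \<Longrightarrow> norm (h z) \<le> exp (norm z powr \<alpha>)" and \<alpha>: "0 < \<alpha>" "\<alpha> < \<nu>"
    and c: "0 < c"
    and P: "\<And>z w. z \<in> S \<Longrightarrow> R0 \<le> norm z \<Longrightarrow> dist z w \<le> 1 \<Longrightarrow> c * norm z powr \<nu> \<le> Re (P w)"
    and q: "\<And>z w. R0 \<le> norm z \<Longrightarrow> dist z w \<le> 1 \<Longrightarrow> norm (q w) \<le> Cq * norm z powr \<mu>"
  shows "\<forall>\<^sub>F r in at_top. \<forall>z \<in> S. norm z = r \<longrightarrow> norm (deriv f z) \<le> 1 + norm (f z)"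
proof -
  \<comment> \<open>Since \<open>(r + 1) powr \<nu> \<le> 2 powr \<nu> * r powr \<nu>\<close>, the
    smallness of \<open>h\<close> uses up at most half of the exponent
    \<open>c * r powr \<nu>\<close>. The choice of \<kappa> > K makes the circles smaller than
    1/(2N).\<close>
  define \<epsilon> where "\<epsilon> = c / (2 * 2 powr \<nu>)"
  define \<kappa> where "\<kappa> = K + 2"
  have \<epsilon>: "\<epsilon> > 0" using c by (simp add: \<epsilon>_def)
  have "\<forall>\<^sub>F r in at_top. \<forall>z. norm z \<le> r \<longrightarrow>
    (\<exists>t. 0 < t \<and> t < r powr - \<kappa> \<and> (\<forall>w. dist z w = t \<longrightarrow> exp (- \<epsilon> * r powr \<nu>) \<le> norm (h w)))"
    by (rule lower_bound_on_small_circles[OF h h\<alpha> \<alpha> _ \<epsilon>]) (use K in \<open>auto simp: \<kappa>_def\<close>)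
  then have "\<forall>\<^sub>F r in at_top. \<forall>z. norm z \<le> r + 1 \<longrightarrow>
    (\<exists>t. 0 < t \<and> t < (r + 1) powr - \<kappa> \<and> (\<forall>w. dist z w = t \<longrightarrow> exp (- \<epsilon> * (r + 1) powr \<nu>) \<le> norm (h w)))"
    by (rule eventually_compose_filterlim) real_asymp
  moreover have "\<forall>\<^sub>F r in at_top. 4 * (2 * ((r+2) powr K + 1) + Cq * r powr \<mu>) \<le> exp (c/2 * r powr \<nu>)"
    using \<alpha> c K by real_asymp
  moreover have "\<forall>\<^sub>F r in at_top. 2 * ((r+2) powr K + 1) \<le> (r + 1) powr \<kappa>"
    unfolding \<kappa>_def using K by real_asymp
  moreover have "\<forall>\<^sub>F r in at_top. r \<ge> max (R0 + 2) 1" by (rule eventually_ge_at_top)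
  ultimately show ?thesis
  proof eventually_elim
    case (elim r)
    have r: "r \<ge> R0 + 2" "r \<ge> 1" "r \<ge> R0" using elim by auto
    show ?case
    proof (intro ballI impI)
      fix z0 assume z0: "z0 \<in> S" "norm z0 = r"
      define N where "N = nat \<lceil>(r+2) powr K\<rceil>"
      have N: "(r+2) powr K \<le> real N" "real N \<le> (r+2) powr K + 1" by (simp_all add: N_def)
      have "1 \<le> (r+2) powr K" using r K by (simp add: ge_one_powr_ge_zero)
      then have N1: "1 \<le> N" using N by linarith
      have nw: "norm w \<le> r + 1" "r - 1 \<le> norm w" if "dist z0 w \<le> 1" for w
        using that z0 norm_triangle_ineq2[of z0 w] norm_triangle_ineq2[of w z0] by (auto simp: dist_norm norm_minus_commute)
      show "norm (deriv f z0) \<le> 1 + norm (f z0)"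
      proof (rule deriv_bound_by_iteration[OF f ode N1])
        fix w assume w: "w \<in> cball z0 1"
        show "norm (q w) \<le> Cq * r powr \<mu>" using q[of z0 w] z0 r w by simp
        have "norm (deriv f w) \<le> exp ((norm w + 1) powr K)"
          by (rule deriv_bound_finite_order[OF f fK]) (use K nw[of w] w r in auto)
        also have "\<dots> \<le> exp ((r+2) powr K)" using nw[of w] w K by (auto intro!: powr_mono2)
        also have "\<dots> \<le> exp (real N)" using N by simp
        also have "\<dots> = exp 1 ^ N" by (simp flip: exp_of_nat_mult)
        also have "\<dots> \<le> 4 ^ N" using exp_le by (intro power_mono) auto
        finally show "norm (deriv f w) \<le> 4 ^ N" .
      next
        show "4 * (2 * real N + Cq * r powr \<mu>) \<le> exp (c/2 * r powr \<nu>)"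
          by (rule order_trans[OF _ elim(2)]) (use N in simp)
      next
        fix z assume z: "z \<in> cball z0 1"
        then have "norm z \<le> r + 1" using nw[of z] by simp
        with elim(1) have "\<exists>t. 0 < t \<and> t < (r + 1) powr - \<kappa> \<and> (\<forall>w. dist z w = t \<longrightarrow> exp (- \<epsilon> * (r + 1) powr \<nu>) \<le> norm (h w))"
          by blast
        then obtain t where t: "0 < t" "t < (r + 1) powr - \<kappa>"
          "\<And>w. dist z w = t \<Longrightarrow> exp (- \<epsilon> * (r + 1) powr \<nu>) \<le> norm (h w)"
          by blast
        have "(r + 1) powr - \<kappa> \<le> 1 / (2 * real N)"
          using elim(3) N N1 r by (simp add: powr_minus field_simps)
        moreover have "exp (c/2 * r powr \<nu>) \<le> norm (h w * exp (P w))" if w: "w \<in> cball z0 1" "dist z w = t" for w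
        proof -
          have "(r+1) powr \<nu> \<le> (2 * r) powr \<nu>" using r \<alpha> by (intro powr_mono2) auto
          then have "\<epsilon> * (r+1) powr \<nu> \<le> \<epsilon> * (2 * r) powr \<nu>" using \<epsilon> by (intro mult_left_mono) auto
          also have "\<dots> = c/2 * r powr \<nu>" using r by (simp add: \<epsilon>_def powr_mult)
          finally have 1: "c/2 * r powr \<nu> \<le> - \<epsilon> * (r+1) powr \<nu> + c * r powr \<nu>" by simp
          have "exp (- \<epsilon> * (r+1) powr \<nu>) * exp (c * r powr \<nu>) \<le> norm (h w) * exp (Re (P w))"
            using t(3)[OF w(2)] P[OF z0(1), of w] z0 r w by (intro mult_mono) auto
          moreover have "exp (c/2 * r powr \<nu>) \<le> exp (- \<epsilon> * (r+1) powr \<nu>) * exp (c * r powr \<nu>)"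
            using 1 by (simp flip: exp_add)
          ultimately show ?thesis by (simp add: norm_mult norm_exp_eq_Re)
        qed
        ultimately show "\<exists>t. 0 < t \<and> t < 1 / (2 * real N) \<and> (\<forall>w\<in>cball z0 1. dist z w = t \<longrightarrow> exp (c/2 * r powr \<nu>) \<le> norm (h w * exp (P w)))"
          using t by (intro exI[of _ t]) auto
      qed
    qed
  qed
qed

section \<open>Sectors where the exponential factor is small\<close>

text \<open>In the coordinates \<open>u = y' + \<mu> r\<^sup>s y\<close> and \<open>v = y' - \<mu> r\<^sup>s y\<close> the equation is diagonal up to
  errors of relative size \<open>1/r\<close>, and \<open>|u|\<^sup>2 - |v|\<^sup>2\<close> is increasing. So either
  \<open>u\<close> eventually dominates, and grows, or \<open>v\<close> dominates for ever, and decays.\<close>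

lemma ray_dichotomy:
  fixes y y1 y2 :: "real \<Rightarrow> complex" and \<mu> :: complex
  assumes \<mu>: "0 < Re \<mu>" and s: "1 \<le> s" and r0: "1 \<le> r0" and C0: "0 \<le> C0"
    and dy: "\<And>r. r0 \<le> r \<Longrightarrow> (y has_vector_derivative y1 r) (at r)"
    and dy1: "\<And>r. r0 \<le> r \<Longrightarrow> (y1 has_vector_derivative y2 r) (at r)"
    and ode: "\<And>r. r0 \<le> r \<Longrightarrow> norm (y2 r - \<mu>\<^sup>2 * of_real (r powr (2 * s)) * y r)
       \<le> C0 * (norm (y1 r) + r powr (2 * s - 1) * norm (y r))"
  obtains R E c where "r0 \<le> R" "0 \<le> E"
    "\<And>r. R \<le> r \<Longrightarrow> norm (y r) \<le> exp (c + Re \<mu> / (s + 1) * r powr (s + 1) + E * r powr s)"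
    "\<And>r. R \<le> r \<Longrightarrow> norm (y1 r) \<le> exp (c + Re \<mu> / (s + 1) * r powr (s + 1) + E * r powr s)"
    "(\<forall>r\<ge>R. norm (y r) \<le> exp (c - Re \<mu> / (s + 1) * r powr (s + 1) + E * r powr s)) \<or>
     (\<exists>R' c'. \<forall>r\<ge>R'. exp (c' + Re \<mu> / (s + 1) * r powr (s + 1) - E * r powr s) \<le>
         norm (y1 r) + norm \<mu> * r powr s * norm (y r))"
proof -
  define l where "l = Re \<mu>"
  have l: "l > 0" "\<mu> \<noteq> 0" using \<mu> by (auto simp: l_def)
  define u where "u = (\<lambda>r. y1 r + \<mu> * of_real (r powr s) * y r)"
  define v where "v = (\<lambda>r. y1 r - \<mu> * of_real (r powr s) * y r)"
  \<comment> \<open>The second summand, here and with opposite sign in \<open>e2\<close>, comes from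
    differentiating the coefficient \<open>r powr s\<close> in the change of coordinates.\<close>
  define e1 where "e1 = (\<lambda>r. (y2 r - \<mu>\<^sup>2 * of_real (r powr (2 * s)) * y r) + \<mu> * of_real (s * r powr (s-1)) * y r)"
  define e2 where "e2 = (\<lambda>r. (y2 r - \<mu>\<^sup>2 * of_real (r powr (2 * s)) * y r) - \<mu> * of_real (s * r powr (s-1)) * y r)"
  have dp: "((\<lambda>r. of_real (r powr s) :: complex) has_vector_derivative of_real (s * r powr (s-1))) (at r)" if "r0 \<le> r" for r
    using that r0 by (intro has_vector_derivative_of_real)
      (auto intro!: derivative_eq_intros simp flip: has_real_derivative_iff_has_vector_derivative)
  have sq: "of_real (r powr (2 * s)) = complex_of_real (r powr s) * of_real (r powr s)" for r
    by (simp flip: powr_add of_real_mult)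
  have sq2: "of_real (r powr (s * 2)) = complex_of_real (r powr s) * of_real (r powr s)" for r
    using sq[of r] by (simp only: mult.commute)
  have du: "(u has_vector_derivative (\<mu> * of_real (r powr s) * u r + e1 r)) (at r)" if "r0 \<le> r" for r
    unfolding u_def
    by (rule has_vector_derivative_eq_rhs, rule derivative_intros, rule dy1[OF that],
        rule derivative_intros, rule derivative_intros, rule dp[OF that], rule dy[OF that])
       (simp add: e1_def sq2 algebra_simps power2_eq_square)
  have dv: "(v has_vector_derivative (- \<mu> * of_real (r powr s) * v r + e2 r)) (at r)" if "r0 \<le> r" for r
    unfolding v_def
    by (rule has_vector_derivative_eq_rhs, rule derivative_intros, rule dy1[OF that],
        rule derivative_intros, rule derivative_intros, rule dp[OF that], rule dy[OF that])
       (simp add: e2_def sq2 algebra_simps power2_eq_square)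
  define n where "n = (\<lambda>r. norm (u r) + norm (v r))"
  define C where "C = C0 / 2 + C0 / (2 * norm \<mu>) + s / 2"
  have C: "0 \<le> C" using C0 s l by (simp add: C_def)
  have y1n: "norm (y1 r) \<le> n r / 2" for r
  proof -
    have "2 * y1 r = u r + v r" by (simp add: u_def v_def)
    then have "2 * norm (y1 r) = norm (u r + v r)" by (metis norm_mult norm_numeral)
    then show ?thesis using norm_triangle_ineq[of "u r" "v r"] by (simp add: n_def)
  qed
  have yn: "norm \<mu> * r powr s * norm (y r) \<le> n r / 2" for r
  proof -
    have "2 * (\<mu> * of_real (r powr s) * y r) = u r - v r" by (simp add: u_def v_def)
    then have "2 * norm (\<mu> * of_real (r powr s) * y r) = norm (u r - v r)" by (metis norm_mult norm_numeral)
    then show ?thesis using norm_triangle_ineq4[of "u r" "v r"] by (simp add: n_def norm_mult)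
  qed
  have ebound: "norm (e1 r) \<le> C * r powr (s-1) * n r \<and> norm (e2 r) \<le> C * r powr (s-1) * n r" if r: "r0 \<le> r" for r
  proof -
    have r1: "1 \<le> r" using r r0 by simp
    have n0: "0 \<le> n r" by (simp add: n_def)
    have ps: "1 \<le> r powr (s-1)" using r1 s by (simp add: ge_one_powr_ge_zero)
    define Y where "Y = r powr s * norm (y r)"
    have Y: "Y \<le> n r / (2 * norm \<mu>)" using yn[of r] l by (simp add: Y_def field_simps)
    have "r powr (2 * s-1) * norm (y r) = r powr (s-1) * Y"
      using r1 by (simp add: Y_def flip: powr_add)
    then have a: "norm (y2 r - \<mu>\<^sup>2 * of_real (r powr (2 * s)) * y r) \<le> C0 * (n r / 2 + r powr (s-1) * (n r / (2 * norm \<mu>)))"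
      using ode[OF r] y1n[of r] mult_left_mono[OF Y, of "r powr (s-1)"] C0
      by (intro order_trans[OF ode[OF r]] mult_left_mono add_mono) (simp_all only: powr_ge_zero)
    have "C0 * (n r / 2 + r powr (s-1) * (n r / (2 * norm \<mu>))) \<le> C0 * (r powr (s-1) * (n r / 2) + r powr (s-1) * (n r / (2 * norm \<mu>)))"
      using C0 ps n0 by (intro mult_left_mono add_mono) (auto simp: mult_le_cancel_right1)
    also have "\<dots> = (C0 / 2 + C0 / (2 * norm \<mu>)) * r powr (s-1) * n r" by (simp add: algebra_simps)
    finally have a: "norm (y2 r - \<mu>\<^sup>2 * of_real (r powr (2 * s)) * y r) \<le> (C0 / 2 + C0 / (2 * norm \<mu>)) * r powr (s-1) * n r"
      using a by simp
    have "norm (\<mu> * of_real (s * r powr (s-1)) * y r) \<le> s * r powr (s-1) * (norm \<mu> * r powr s * norm (y r))"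
    proof -
      have "norm (\<mu> * of_real (s * r powr (s-1)) * y r) = s * r powr (s-1) * (norm \<mu> * 1 * norm (y r))"
        using s by (simp add: norm_mult)
      also have "\<dots> \<le> s * r powr (s-1) * (norm \<mu> * r powr s * norm (y r))"
        using s r1 by (intro mult_left_mono mult_right_mono) (auto simp: ge_one_powr_ge_zero)
      finally show ?thesis .
    qed
    also have "\<dots> \<le> s * r powr (s-1) * (n r / 2)" using yn[of r] s by (intro mult_left_mono) auto
    finally have b: "norm (\<mu> * of_real (s * r powr (s-1)) * y r) \<le> s / 2 * r powr (s-1) * n r" by simp
    have "C * r powr (s-1) * n r = (C0 / 2 + C0 / (2 * norm \<mu>)) * r powr (s-1) * n r + s / 2 * r powr (s-1) * n r"
      by (simp add: C_def algebra_simps)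
    then show ?thesis unfolding e1_def e2_def
      using a b norm_triangle_ineq norm_triangle_ineq4 by (smt (verit))
  qed
  define U where "U = (\<lambda>r. (norm (u r))\<^sup>2)"
  define V where "V = (\<lambda>r. (norm (v r))\<^sup>2)"
  define U' where "U' = (\<lambda>r. 2 * (l * r powr s * U r + u r \<bullet> e1 r))"
  define V' where "V' = (\<lambda>r. 2 * (- l * r powr s * V r + v r \<bullet> e2 r))"
  have dU: "(U has_real_derivative U' r) (at r)" if "r0 \<le> r" for r
  proof -
    have "((\<lambda>r. u r \<bullet> u r) has_real_derivative (u r \<bullet> (\<mu> * of_real (r powr s) * u r + e1 r) + (\<mu> * of_real (r powr s) * u r + e1 r) \<bullet> u r)) (at r)"
      unfolding has_field_derivative_def
      by (rule has_derivative_eq_rhs[OF has_derivative_inner[OF du[OF that, unfolded has_vector_derivative_def] du[OF that, unfolded has_vector_derivative_def]]])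
         (simp add: fun_eq_iff inner_scaleR_left inner_scaleR_right algebra_simps)
    moreover have "u r \<bullet> (\<mu> * of_real (r powr s) * u r) = l * r powr s * U r"
      unfolding U_def l_def cmod_power2 by (simp add: inner_complex_def algebra_simps power2_eq_square)
    ultimately show ?thesis
      by (simp add: U'_def U_def power2_norm_eq_inner inner_add_right inner_commute algebra_simps)
  qed
  have dV: "(V has_real_derivative V' r) (at r)" if "r0 \<le> r" for r
  proof -
    have "((\<lambda>r. v r \<bullet> v r) has_real_derivative (v r \<bullet> (- \<mu> * of_real (r powr s) * v r + e2 r) + (- \<mu> * of_real (r powr s) * v r + e2 r) \<bullet> v r)) (at r)"
      unfolding has_field_derivative_def
      by (rule has_derivative_eq_rhs[OF has_derivative_inner[OF dv[OF that, unfolded has_vector_derivative_def] dv[OF that, unfolded has_vector_derivative_def]]])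
         (simp add: fun_eq_iff inner_scaleR_left inner_scaleR_right algebra_simps)
    moreover have "v r \<bullet> (- \<mu> * of_real (r powr s) * v r) = - l * r powr s * V r"
      unfolding V_def l_def cmod_power2 by (simp add: inner_complex_def algebra_simps power2_eq_square)
    ultimately show ?thesis
      by (simp add: V'_def V_def power2_norm_eq_inner inner_add_right inner_commute algebra_simps)
  qed
  \<comment> \<open>The 4 is 2 times 2: once from (|u| + |v|)^2 <= 2 (U + V), once from
    differentiating the squares.\<close>
  define \<delta> where "\<delta> = (\<lambda>r. 4 * C * r powr (s-1))"
  have inner_e: "\<bar>u r \<bullet> e1 r\<bar> + \<bar>v r \<bullet> e2 r\<bar> \<le> \<delta> r / 2 * (U r + V r)" if "r0 \<le> r" for r
  proof -
    have "\<bar>u r \<bullet> e1 r\<bar> + \<bar>v r \<bullet> e2 r\<bar> \<le> norm (u r) * (C * r powr (s-1) * n r) + norm (v r) * (C * r powr (s-1) * n r)"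
      by (intro add_mono order_trans[OF Cauchy_Schwarz_ineq2] mult_left_mono) (use ebound[OF that] in auto)
    also have "\<dots> = C * r powr (s-1) * (n r)\<^sup>2" by (simp add: n_def power2_eq_square algebra_simps)
    also have "(n r)\<^sup>2 \<le> 2 * (U r + V r)"
      unfolding n_def U_def V_def using zero_le_power2[of "norm (u r) - norm (v r)"]
      by (simp add: power2_eq_square algebra_simps)
    then have "C * r powr (s-1) * (n r)\<^sup>2 \<le> C * r powr (s-1) * (2 * (U r + V r))" using C by (intro mult_left_mono) auto
    finally show ?thesis by (simp add: \<delta>_def algebra_simps)
  qed
  have UV0: "0 \<le> U r" "0 \<le> V r" for r by (simp_all add: U_def V_def)
  \<comment> \<open>\<Phi> and \<Psi> are primitives of the leading rate
    \<open>2 * l * r powr s\<close> and of the error rate \<delta>; both carry a factor 2 because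
    they measure squared norms.\<close>
  define \<Phi> where "\<Phi> = (\<lambda>r. 2 * (l / (s+1) * r powr (s+1)))"
  define \<Psi> where "\<Psi> = (\<lambda>r. (4 * C / s) * r powr s)"
  have Phi: "\<Phi> r = 2 * (l / (s+1) * r powr (s+1))" for r by (simp add: \<Phi>_def)
  have d\<Phi>: "(\<Phi> has_real_derivative 2 * l * r powr s) (at r)" if "r0 \<le> r" for r
    unfolding \<Phi>_def using that r0 s by (auto intro!: derivative_eq_intros)
  have d\<Psi>: "(\<Psi> has_real_derivative \<delta> r) (at r)" if "r0 \<le> r" for r
    unfolding \<Psi>_def \<delta>_def using that r0 s by (auto intro!: derivative_eq_intros)
  have "\<forall>\<^sub>F r in at_top. \<delta> r \<le> 2 * l * r powr s"
    unfolding \<delta>_def using l by real_asymp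
  then obtain R where R: "r0 \<le> R" "\<And>r. R \<le> r \<Longrightarrow> \<delta> r \<le> 2 * l * r powr s"
    unfolding eventually_at_top_linorder by (metis max.bounded_iff max.cobounded1 max.cobounded2 order.trans)
  \<comment> \<open>\<open>W * exp (- g)\<close> is nondecreasing, whatever the sign of
    \<open>W\<close>; upper bounds are obtained by applying this to negated functions.\<close>
  have gronwall: "W r \<ge> W a * exp (g r - g a)" if "a \<le> r" "r0 \<le> a"
    and dW: "\<And>x. a \<le> x \<Longrightarrow> (W has_real_derivative W' x) (at x)" and dg: "\<And>x. a \<le> x \<Longrightarrow> (g has_real_derivative g' x) (at x)"
    and le: "\<And>x. a \<le> x \<Longrightarrow> g' x * W x \<le> W' x" for W W' g g' :: "real \<Rightarrow> real" and a r
  proof -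
    have "W a * exp (- g a) \<le> W r * exp (- g r)"
    proof (rule DERIV_nonneg_imp_nondecreasing[OF that(1)])
      fix x assume "a \<le> x" "x \<le> r"
      then have "((\<lambda>x. W x * exp (- g x)) has_real_derivative (W' x - g' x * W x) * exp (- g x)) (at x)"
        by (auto intro!: derivative_eq_intros dW dg simp: algebra_simps)
      then show "\<exists>y. ((\<lambda>x. W x * exp (- g x)) has_real_derivative y) (at x) \<and> 0 \<le> y"
        using le[OF \<open>a \<le> x\<close>] by (intro exI conjI) auto
    qed
    then show ?thesis by (simp add: exp_diff exp_minus field_simps)
  qed
  have upper: "U r + V r \<le> (U R + V R) * exp (\<Phi> r + \<Psi> r - (\<Phi> R + \<Psi> R))" if r: "R \<le> r" for r
  proof -
    have "- (U R + V R) * exp (\<Phi> r + \<Psi> r - (\<Phi> R + \<Psi> R)) \<le> - (U r + V r)"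
    proof (rule gronwall[of R r "\<lambda>r. - (U r + V r)" "\<lambda>r. - (U' r + V' r)" "\<lambda>r. \<Phi> r + \<Psi> r" "\<lambda>r. 2 * l * r powr s + \<delta> r"])
      fix x assume x: "R \<le> x"
      then have x0: "r0 \<le> x" using R by simp
      show "((\<lambda>r. - (U r + V r)) has_real_derivative - (U' x + V' x)) (at x)"
        by (intro derivative_intros dU dV x0)
      show "((\<lambda>r. \<Phi> r + \<Psi> r) has_real_derivative 2 * l * x powr s + \<delta> x) (at x)"
        by (intro derivative_intros d\<Phi> d\<Psi> x0)
      have "0 \<le> l * x powr s * V x" using l UV0 by simp
      then show "(2 * l * x powr s + \<delta> x) * - (U x + V x) \<le> - (U' x + V' x)"
        using inner_e[OF x0] by (simp add: U'_def V'_def algebra_simps)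
    qed (use r R in auto)
    then show ?thesis by (simp only: mult_minus_left neg_le_iff_le)
  qed
  \<comment> \<open>The leading terms of \<open>U'\<close> and \<open>V'\<close> have opposite signs
    and so add up in the difference. Hence \<open>U - V\<close> is nondecreasing once \<delta> is at
    most \<open>2 * l * r powr s\<close>, that is beyond \<open>R\<close>.\<close>
  have D': "(2 * l * r powr s - \<delta> r) * (U r + V r) \<le> U' r - V' r" if "r0 \<le> r" for r
    using inner_e[OF that] by (simp add: U'_def V'_def algebra_simps)
  define K where "K = max 1 (U R + V R)"
  define E where "E = 2 * C / s"
  have E: "0 \<le> E" "\<Psi> r = 2 * (E * r powr s)" for r using C s by (auto simp: E_def \<Psi>_def)
  have \<Psi>0: "0 \<le> \<Psi> r" "0 \<le> \<Phi> r" for r using E l s by (auto simp: \<Phi>_def)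
  \<comment> \<open>The last summand covers both conversions from \<open>u\<close> and
    \<open>v\<close>: the factor 1 for \<open>y1\<close> and the factor
    \<open>1 / norm \<mu>\<close> for \<open>y\<close>.\<close>
  define c where "c = ln K / 2 + \<Phi> R + ln (1 + 1 / norm \<mu>)"
  have K1: "1 \<le> K" by (simp add: K_def)
  have lnl: "0 \<le> ln (1 + 1 / norm \<mu>)" using l by simp
  \<comment> \<open>\<open>X\<close> is the signed leading exponent: positive for the general upper
    bound, negative in the decaying case.\<close>
  have from_sq: "norm (y1 r) \<le> exp (c + X + E * r powr s)" "norm (y r) \<le> exp (c + X + E * r powr s)"
    if r: "R \<le> r" and b: "U r \<le> K * exp (2 * \<Phi> R + 2 * X + \<Psi> r)" "V r \<le> K * exp (2 * \<Phi> R + 2 * X + \<Psi> r)" for r X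
  proof -
    have r1: "1 \<le> r" using r r0 R by simp
    define Z where "Z = exp (ln K / 2 + \<Phi> R + X + E * r powr s)"
    have Z2: "Z\<^sup>2 = K * exp (2 * \<Phi> R + 2 * X + \<Psi> r)"
    proof -
      have "Z\<^sup>2 = exp (ln K + (2 * \<Phi> R + 2 * X + \<Psi> r))"
        unfolding Z_def by (simp add: E(2) algebra_simps flip: exp_double)
      then show ?thesis using K1 by (simp add: exp_add)
    qed
    have "norm (u r) \<le> Z" using b(1) unfolding Z2[symmetric] U_def by (rule power2_le_imp_le) (simp add: Z_def)
    moreover have "norm (v r) \<le> Z" using b(2) unfolding Z2[symmetric] V_def by (rule power2_le_imp_le) (simp add: Z_def)
    ultimately have nZ: "n r / 2 \<le> Z" by (simp add: n_def)
    have ZE: "Z * (1 + 1 / norm \<mu>) = exp (c + X + E * r powr s)"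
    proof -
      have "exp (c + X + E * r powr s) = exp (ln K / 2 + \<Phi> R + X + E * r powr s + ln (1 + 1 / norm \<mu>))"
        by (simp add: c_def algebra_simps)
      also have "\<dots> = Z * exp (ln (1 + 1 / norm \<mu>))" unfolding Z_def by (rule exp_add)
      also have "exp (ln (1 + 1 / norm \<mu>)) = 1 + 1 / norm \<mu>" using l by (intro exp_ln) (simp add: add_pos_pos)
      finally show ?thesis by simp
    qed
    have Z0: "0 < Z" by (simp add: Z_def)
    have "norm (y1 r) \<le> Z" using y1n[of r] nZ by simp
    also have "Z \<le> Z * (1 + 1 / norm \<mu>)" using Z0 by (simp add: mult_le_cancel_left1)
    finally show "norm (y1 r) \<le> exp (c + X + E * r powr s)" unfolding ZE .
    have "norm \<mu> * 1 * norm (y r) \<le> norm \<mu> * r powr s * norm (y r)"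
      using r1 s by (intro mult_right_mono mult_left_mono) (auto simp: ge_one_powr_ge_zero)
    also have "\<dots> \<le> Z" using yn[of r] nZ by simp
    finally have "norm (y r) \<le> Z / norm \<mu>" using l by (simp add: field_simps)
    also have "\<dots> \<le> Z * (1 + 1 / norm \<mu>)" using Z0 by (simp add: algebra_simps)
    finally show "norm (y r) \<le> exp (c + X + E * r powr s)" unfolding ZE .
  qed
  have up: "U r \<le> K * exp (2 * \<Phi> R + 2 * (l / (s+1) * r powr (s+1)) + \<Psi> r)"
           "V r \<le> K * exp (2 * \<Phi> R + 2 * (l / (s+1) * r powr (s+1)) + \<Psi> r)" if r: "R \<le> r" for r
  proof -
    have "(U R + V R) * exp (\<Phi> r + \<Psi> r - (\<Phi> R + \<Psi> R)) \<le> K * exp (2 * \<Phi> R + 2 * (l / (s+1) * r powr (s+1)) + \<Psi> r)"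
      using \<Psi>0[of R] UV0 by (intro mult_mono) (auto simp: K_def Phi[of r])
    then show "U r \<le> K * exp (2 * \<Phi> R + 2 * (l / (s+1) * r powr (s+1)) + \<Psi> r)"
           "V r \<le> K * exp (2 * \<Phi> R + 2 * (l / (s+1) * r powr (s+1)) + \<Psi> r)"
      using upper[OF r] UV0[of r] by linarith+
  qed
  show thesis
  proof (rule that[of R E c])
    show "r0 \<le> R" "0 \<le> E" by fact+
    show "norm (y r) \<le> exp (c + Re \<mu> / (s + 1) * r powr (s + 1) + E * r powr s)"
         "norm (y1 r) \<le> exp (c + Re \<mu> / (s + 1) * r powr (s + 1) + E * r powr s)" if "R \<le> r" for r
      using from_sq[OF that up[OF that]] by (simp_all add: l_def)
    show "(\<forall>r\<ge>R. norm (y r) \<le> exp (c - Re \<mu> / (s + 1) * r powr (s + 1) + E * r powr s)) \<or>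
     (\<exists>R' c'. \<forall>r\<ge>R'. exp (c' + Re \<mu> / (s + 1) * r powr (s + 1) - E * r powr s) \<le>
         norm (y1 r) + norm \<mu> * r powr s * norm (y r))"
    proof (cases "\<exists>a\<ge>R. V a < U a")
      case True
      then obtain a where a: "R \<le> a" "V a < U a" by blast
      have mono: "0 \<le> U r - V r" if "a \<le> r" for r
      proof -
        have "U a - V a \<le> U r - V r"
        proof (rule DERIV_nonneg_imp_nondecreasing[OF that])
          fix x assume "a \<le> x" "x \<le> r"
          then have x: "R \<le> x" "r0 \<le> x" using a R by auto
          have "0 \<le> (2 * l * x powr s - \<delta> x) * (U x + V x)" using R(2)[OF x(1)] UV0[of x] by (intro mult_nonneg_nonneg) auto
          then show "\<exists>y. ((\<lambda>r. U r - V r) has_real_derivative y) (at x) \<and> 0 \<le> y"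
            using D'[OF x(2)] by (intro exI[of _ "U' x - V' x"] conjI derivative_intros dU dV x) auto
        qed
        then show ?thesis using a by simp
      qed
      define c' where "c' = ln (U a - V a) / 2 - (\<Phi> a - \<Psi> a) / 2"
      have "exp (c' + l / (s + 1) * r powr (s + 1) - E * r powr s) \<le> norm (y1 r) + norm \<mu> * r powr s * norm (y r)" if r: "a \<le> r" for r
      proof -
        have "(U a - V a) * exp (\<Phi> r - \<Psi> r - (\<Phi> a - \<Psi> a)) \<le> U r - V r"
        proof (rule gronwall[of a r "\<lambda>r. U r - V r" "\<lambda>r. U' r - V' r" "\<lambda>r. \<Phi> r - \<Psi> r" "\<lambda>r. 2 * l * r powr s - \<delta> r"])
          fix x assume x: "a \<le> x"
          then have xR: "R \<le> x" "r0 \<le> x" using R a by simp_all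
          show "((\<lambda>r. U r - V r) has_real_derivative U' x - V' x) (at x)"
            by (intro derivative_intros dU dV xR)
          show "((\<lambda>r. \<Phi> r - \<Psi> r) has_real_derivative 2 * l * x powr s - \<delta> x) (at x)"
            by (intro derivative_intros d\<Phi> d\<Psi> xR)
          have "(2 * l * x powr s - \<delta> x) * (U x - V x) \<le> (2 * l * x powr s - \<delta> x) * (U x + V x)"
            using R(2)[OF xR(1)] UV0[of x] by (intro mult_left_mono) auto
          then show "(2 * l * x powr s - \<delta> x) * (U x - V x) \<le> U' x - V' x" using D'[OF xR(2)] by simp
        qed (use r R a in auto)
        also have "\<dots> \<le> U r" using UV0 by simp
        finally have "exp (ln (U a - V a) + (\<Phi> r - \<Psi> r - (\<Phi> a - \<Psi> a))) \<le> U r" using a by (simp add: exp_add)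
        also have "exp (ln (U a - V a) + (\<Phi> r - \<Psi> r - (\<Phi> a - \<Psi> a))) = (exp (c' + l / (s + 1) * r powr (s + 1) - E * r powr s))\<^sup>2"
          by (simp add: c'_def E(2) Phi[of r] algebra_simps diff_divide_distrib add_divide_distrib flip: exp_double)
        finally have "exp (c' + l / (s + 1) * r powr (s + 1) - E * r powr s) \<le> norm (u r)"
          unfolding U_def by (rule power2_le_imp_le) simp
        also have "\<dots> \<le> norm (y1 r) + norm \<mu> * r powr s * norm (y r)"
          unfolding u_def by (rule order_trans[OF norm_triangle_ineq]) (simp add: norm_mult)
        finally show ?thesis .
      qed
      then show ?thesis unfolding l_def by blast
    next
      case False
      then have le: "U r \<le> V r" if "R \<le> r" for r using that by (meson not_le)
      have "norm (y r) \<le> exp (c + (- (l / (s + 1) * r powr (s + 1))) + E * r powr s)" if r: "R \<le> r" for r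
      proof (rule from_sq(2)[OF r])
        have "- V R * exp (- \<Phi> r + \<Psi> r - (- \<Phi> R + \<Psi> R)) \<le> - V r"
        proof (rule gronwall[of R r "\<lambda>r. - V r" "\<lambda>r. - V' r" "\<lambda>r. - \<Phi> r + \<Psi> r" "\<lambda>r. - (2 * l * r powr s) + \<delta> r"])
          fix x assume x: "R \<le> x"
          then have x0: "r0 \<le> x" using R by simp
          show "((\<lambda>r. - V r) has_real_derivative - V' x) (at x)"
            by (intro derivative_intros dV x0)
          show "((\<lambda>r. - \<Phi> r + \<Psi> r) has_real_derivative - (2 * l * x powr s) + \<delta> x) (at x)"
            by (intro derivative_intros d\<Phi> d\<Psi> x0)
          \<comment> \<open>As \<open>u\<close> never dominates, the error in the equation for
            \<open>V\<close> is controlled by \<open>v\<close> alone, so the differential inequality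
            for \<open>V\<close> closes.\<close>
          have "norm (u x) \<le> norm (v x)" using le[OF x] unfolding U_def V_def by (rule power2_le_imp_le) simp
          then have n2: "n x \<le> 2 * norm (v x)" by (simp add: n_def)
          have "v x \<bullet> e2 x \<le> norm (v x) * (C * x powr (s-1) * n x)"
            by (intro order_trans[OF norm_cauchy_schwarz] mult_left_mono) (use ebound[OF x0] in auto)
          also have "\<dots> \<le> norm (v x) * (C * x powr (s-1) * (2 * norm (v x)))"
            using C n2 by (intro mult_left_mono) auto
          also have "\<dots> = \<delta> x / 2 * V x" by (simp add: \<delta>_def V_def power2_eq_square)
          finally show "(- (2 * l * x powr s) + \<delta> x) * - V x \<le> - V' x"
            by (simp add: V'_def algebra_simps)
        qed (use r R in auto)
        then have "V r \<le> V R * exp (- \<Phi> r + \<Psi> r - (- \<Phi> R + \<Psi> R))" by simp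
        also have "\<dots> \<le> K * exp (2 * \<Phi> R + 2 * - (l / (s+1) * r powr (s+1)) + \<Psi> r)"
          using \<Psi>0[of R] UV0[of R] by (intro mult_mono) (auto simp: K_def Phi[of r] add_increasing)
        finally show *: "V r \<le> K * exp (2 * \<Phi> R + 2 * - (l / (s+1) * r powr (s+1)) + \<Psi> r)" .
        then show "U r \<le> K * exp (2 * \<Phi> R + 2 * - (l / (s+1) * r powr (s+1)) + \<Psi> r)" using le[OF r] by simp
      qed
      then show ?thesis by (simp add: l_def)
    qed
  qed
qed

section \<open>Polynomials compared with their leading terms\<close>

lemma poly_lead_bound:
  fixes p :: "complex poly"
  assumes "1 \<le> degree p"
  obtains C where "0 \<le> C" "\<And>z. 1 \<le> norm z \<Longrightarrow> norm (poly p z - lead_coeff p * z ^ degree p) \<le> C * norm z ^ (degree p - 1)"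
proof -
  define C where "C = (\<Sum>i<degree p. norm (coeff p i))"
  have "norm (poly p z - lead_coeff p * z ^ degree p) \<le> C * norm z ^ (degree p - 1)" if z: "1 \<le> norm z" for z
  proof -
    have "poly p z = (\<Sum>i<degree p. coeff p i * z ^ i) + lead_coeff p * z ^ degree p"
      by (simp add: poly_altdef flip: lessThan_Suc_atMost)
    then have "norm (poly p z - lead_coeff p * z ^ degree p) = norm (\<Sum>i<degree p. coeff p i * z ^ i)" by simp
    also have "\<dots> \<le> (\<Sum>i<degree p. norm (coeff p i) * norm z ^ (degree p - 1))"
      by (rule sum_norm_le) (use z in \<open>auto simp: norm_mult norm_power intro!: mult_left_mono power_increasing\<close>)
    finally show ?thesis by (simp add: C_def sum_distrib_right)
  qed
  moreover have "0 \<le> C" by (simp add: C_def sum_nonneg)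
  ultimately show thesis using that by blast
qed

lemma poly_upper_bound:
  fixes p :: "complex poly"
  obtains C where "0 \<le> C" "\<And>z. 1 \<le> norm z \<Longrightarrow> norm (poly p z) \<le> C * norm z ^ degree p"
proof -
  define C where "C = (\<Sum>i\<le>degree p. norm (coeff p i))"
  have "norm (poly p z) \<le> C * norm z ^ degree p" if z: "1 \<le> norm z" for z
  proof -
    have "norm (poly p z) \<le> (\<Sum>i\<le>degree p. norm (coeff p i) * norm z ^ degree p)"
      unfolding poly_altdef
      by (rule sum_norm_le) (use z in \<open>auto simp: norm_mult norm_power intro!: mult_left_mono power_increasing\<close>)
    then show ?thesis by (simp add: C_def sum_distrib_right)
  qed
  moreover have "0 \<le> C" by (simp add: C_def sum_nonneg)
  ultimately show thesis using that by blast
qed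

text \<open>For \<open>Im b > 0\<close> the real part has the sign of
  \<open>- sin (n * \<theta>)\<close>: under this normalisation the exponential is large just below
  the ray \<theta> = 0 and small just above it.\<close>

lemma Re_lead_term:
  assumes "Re b = 0"
  shows "Re (b * rcis r \<theta> ^ n) = - Im b * r ^ n * sin (real n * \<theta>)"
  unfolding DeMoivre2 using assms by simp

text \<open>The iteration uses the equation on a whole unit disc, so the bound must hold at all
  \<open>w\<close> near the point. Moving by at most 1 changes \<open>p\<close> by O(r^(n-1)), which
  half of the leading term absorbs; the margin \<open>s0\<close> makes the constants uniform in
  \<theta>.\<close>

lemma Re_poly_large:
  fixes p :: "complex poly"
  assumes n: "degree p = n" "1 \<le> n" and lead: "Re (lead_coeff p) = 0" "0 < Im (lead_coeff p)"
    and s0: "0 < s0"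
  obtains c R where "0 < c" "1 \<le> R" "\<And>r \<theta> w. R \<le> r \<Longrightarrow> sin (real n * \<theta>) \<le> - s0 \<Longrightarrow> dist (rcis r \<theta>) w \<le> 1 \<Longrightarrow>
      c * r powr real n \<le> Re (poly p w)"
proof -
  define a where "a = Im (lead_coeff p)"
  define c where "c = a * s0 / 2"
  have c: "0 < c" using lead s0 by (simp add: c_def a_def)
  obtain C where C: "0 \<le> C" "\<And>z. 1 \<le> norm z \<Longrightarrow> norm (poly p z - lead_coeff p * z ^ degree p) \<le> C * norm z ^ (degree p - 1)"
    using poly_lead_bound[of p] n by auto
  obtain D where D: "0 \<le> D" "\<And>z. 1 \<le> norm z \<Longrightarrow> norm (poly (pderiv p) z) \<le> D * norm z ^ (n - 1)"
    using poly_upper_bound[of "pderiv p"] n by (auto simp: degree_pderiv)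
  have "\<forall>\<^sub>F r::real in at_top. C * r powr (real n - 1) + D * (r+1) powr (real n - 1) \<le> c * r powr real n"
    using c by real_asymp
  then obtain R where R: "\<And>r. R \<le> r \<Longrightarrow> C * r powr (real n - 1) + D * (r+1) powr (real n - 1) \<le> c * r powr real n"
    unfolding eventually_at_top_linorder by auto
  have "c * r powr real n \<le> Re (poly p w)"
    if r: "max R 2 \<le> r" and \<theta>: "sin (real n * \<theta>) \<le> - s0" and w: "dist (rcis r \<theta>) w \<le> 1" for r \<theta> w
  proof -
    define z where "z = rcis r \<theta>"
    have r2: "2 \<le> r" "R \<le> r" using r by auto
    have nz: "norm z = r" using r2 by (simp add: z_def)
    have pw: "x ^ (n - 1) = x powr (real n - 1)" "x ^ n = x powr real n" if "0 < x" for x :: real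
      using that n by (auto simp: powr_realpow[symmetric] of_nat_diff)
    have "norm (poly p w - poly p z) \<le> D * (r+1) ^ (n-1) * norm (w - z)"
    proof (rule field_differentiable_bound[of "cball z 1"])
      fix u assume u: "u \<in> cball z 1"
      show "(poly p has_field_derivative poly (pderiv p) u) (at u within cball z 1)"
        using poly_DERIV DERIV_subset by blast
      have nu: "1 \<le> norm u" "norm u \<le> r + 1"
        using u nz r2 norm_triangle_ineq2[of z u] norm_triangle_ineq2[of u z] by (auto simp: dist_norm norm_minus_commute)
      then show "norm (poly (pderiv p) u) \<le> D * (r+1) ^ (n-1)"
        using D by (intro order_trans[OF D(2)] mult_left_mono power_mono) auto
    qed (use w in \<open>auto simp: z_def\<close>)
    also have "\<dots> \<le> D * (r+1) ^ (n-1) * 1" using w D r2 by (intro mult_left_mono) (auto simp: z_def dist_norm norm_minus_commute)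
    finally have 1: "norm (poly p w - poly p z) \<le> D * (r+1) powr (real n - 1)" using pw r2 by simp
    have 2: "norm (poly p z - lead_coeff p * z ^ n) \<le> C * r powr (real n - 1)"
      using C(2)[of z] nz r2 n pw[of r] by simp
    have "a * r ^ n * sin (real n * \<theta>) \<le> a * r ^ n * (- s0)" using \<theta> lead r2 by (intro mult_left_mono) (auto simp: a_def)
    then have 3: "2 * c * r powr real n \<le> Re (lead_coeff p * z ^ n)"
      unfolding z_def Re_lead_term[OF lead(1)] using pw[of r] r2 by (simp add: a_def c_def algebra_simps)
    have "Re (lead_coeff p * z ^ n) - Re (poly p z) \<le> norm (poly p z - lead_coeff p * z ^ n)"
         "Re (poly p z) - Re (poly p w) \<le> norm (poly p w - poly p z)"
      using complex_Re_le_cmod[of "lead_coeff p * z ^ n - poly p z"] complex_Re_le_cmod[of "poly p z - poly p w"]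
      by (simp_all add: norm_minus_commute)
    then show ?thesis using 1 2 3 R[OF r2(2)] by linarith
  qed
  then show thesis using that[of c "max R 2"] c by auto
qed

lemma Re_poly_small:
  fixes p :: "complex poly"
  assumes n: "degree p = n" "1 \<le> n" and lead: "Re (lead_coeff p) = 0" "0 < Im (lead_coeff p)"
    and s0: "0 < sin (real n * \<theta>)"
  obtains R c where "0 < c" "1 \<le> R" "\<And>r. R \<le> r \<Longrightarrow> Re (poly p (rcis r \<theta>)) \<le> - c * r powr real n"
proof -
  define a where "a = Im (lead_coeff p)"
  define c where "c = a * sin (real n * \<theta>) / 2"
  have c: "0 < c" using lead s0 by (simp add: c_def a_def)
  obtain C where C: "0 \<le> C" "\<And>z. 1 \<le> norm z \<Longrightarrow> norm (poly p z - lead_coeff p * z ^ degree p) \<le> C * norm z ^ (degree p - 1)"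
    using poly_lead_bound[of p] n by auto
  have "\<forall>\<^sub>F r::real in at_top. C * r powr (real n - 1) \<le> c * r powr real n"
    using c by real_asymp
  then obtain R where R: "\<And>r. R \<le> r \<Longrightarrow> C * r powr (real n - 1) \<le> c * r powr real n"
    unfolding eventually_at_top_linorder by auto
  have "Re (poly p (rcis r \<theta>)) \<le> - c * r powr real n" if r: "max R 1 \<le> r" for r
  proof -
    have r2: "1 \<le> r" "R \<le> r" using r by auto
    have pw: "x ^ (n - 1) = x powr (real n - 1)" "x ^ n = x powr real n" if "0 < x" for x :: real
      using that n by (auto simp: powr_realpow[symmetric] of_nat_diff)
    have "norm (poly p (rcis r \<theta>) - lead_coeff p * rcis r \<theta> ^ n) \<le> C * r powr (real n - 1)"
      using C(2)[of "rcis r \<theta>"] r2 n pw[of r] by simp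
    moreover have "Re (lead_coeff p * rcis r \<theta> ^ n) = - 2 * c * r powr real n"
      unfolding Re_lead_term[OF lead(1)] using pw[of r] r2 by (simp add: a_def c_def)
    moreover have "Re (poly p (rcis r \<theta>)) - Re (lead_coeff p * rcis r \<theta> ^ n) \<le> norm (poly p (rcis r \<theta>) - lead_coeff p * rcis r \<theta> ^ n)"
      using complex_Re_le_cmod[of "poly p (rcis r \<theta>) - lead_coeff p * rcis r \<theta> ^ n"] by simp
    ultimately show ?thesis using R[OF r2(2)] by simp
  qed
  then show thesis using that[of c "max R 1"] c by auto
qed

section \<open>Solutions along rays\<close>

text \<open>1 + |y|^2 is differentiable even where \<open>y\<close> vanishes, and its logarithmic
  derivative is at most 3, because 2|y|(1 + |y|) <= 1 + 3|y|^2.\<close>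

lemma ray_gronwall:
  fixes y y1 :: "real \<Rightarrow> complex"
  assumes dy: "\<And>r. R \<le> r \<Longrightarrow> (y has_vector_derivative y1 r) (at r)"
    and le: "\<And>r. R \<le> r \<Longrightarrow> norm (y1 r) \<le> 1 + norm (y r)" and r: "R \<le> r"
  shows "1 + (norm (y r))\<^sup>2 \<le> (1 + (norm (y R))\<^sup>2) * exp (3 * (r - R))"
proof -
  have "(1 + (norm (y r))\<^sup>2) * exp (- 3 * r) \<le> (1 + (norm (y R))\<^sup>2) * exp (- 3 * R)"
  proof (rule DERIV_nonpos_imp_nonincreasing[OF r])
    fix x assume "R \<le> x" "x \<le> r"
    have "((\<lambda>r. y r \<bullet> y r) has_real_derivative (2 * (y x \<bullet> y1 x))) (at x)"
      unfolding has_field_derivative_def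
      by (rule has_derivative_eq_rhs[OF has_derivative_inner[OF dy[OF \<open>R \<le> x\<close>, unfolded has_vector_derivative_def] dy[OF \<open>R \<le> x\<close>, unfolded has_vector_derivative_def]]])
         (simp add: fun_eq_iff inner_scaleR_left inner_scaleR_right inner_commute algebra_simps)
    then have "((\<lambda>r. (1 + (norm (y r))\<^sup>2) * exp (- 3 * r)) has_real_derivative
       (2 * (y x \<bullet> y1 x) - 3 * (1 + (norm (y x))\<^sup>2)) * exp (- 3 * x)) (at x)"
      unfolding power2_norm_eq_inner by (auto intro!: derivative_eq_intros simp: algebra_simps)
    moreover have "2 * (y x \<bullet> y1 x) - 3 * (1 + (norm (y x))\<^sup>2) \<le> 0"
    proof -
      have "y x \<bullet> y1 x \<le> norm (y x) * (1 + norm (y x))"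
        by (rule order_trans[OF norm_cauchy_schwarz mult_left_mono[OF le[OF \<open>R \<le> x\<close>]]]) simp
      moreover have "0 \<le> (norm (y x) - 1)\<^sup>2" by simp
      ultimately show ?thesis by (simp add: power2_eq_square algebra_simps)
    qed
    ultimately show "\<exists>D. ((\<lambda>r. (1 + (norm (y r))\<^sup>2) * exp (- 3 * r)) has_real_derivative D) (at x) \<and> D \<le> 0"
      by (intro exI conjI) (auto simp: mult_nonpos_nonneg)
  qed
  then show ?thesis by (simp add: exp_minus exp_diff right_diff_distrib field_simps)
qed

lemma has_vector_derivative_ray:
  assumes "f holomorphic_on UNIV"
  shows "((\<lambda>r. f (rcis r \<theta>)) has_vector_derivative cis \<theta> * deriv f (rcis r \<theta>)) (at r)"
proof -
  have "((\<lambda>r. rcis r \<theta>) has_vector_derivative cis \<theta>) (at r)"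
    using bounded_linear_imp_has_derivative[OF bounded_linear_scaleR_left[of "cis \<theta>"], of "at r"]
    by (simp add: has_vector_derivative_def rcis_def scaleR_conv_of_real)
  moreover have "(f has_field_derivative deriv f (rcis r \<theta>)) (at (rcis r \<theta>))"
    using assms by (meson UNIV_I holomorphic_derivI open_UNIV)
  ultimately show ?thesis
    using field_vector_diff_chain_at[of "\<lambda>r. rcis r \<theta>" "cis \<theta>" r f] by (simp add: o_def)
qed

text \<open>Integrates |f'| <= 1 + |f| along the rays. The constants do not depend on \<theta>, as
  finite order bounds the initial value at radius \<open>R\<close> for all angles at once. Of the
  bound only the order 1, smaller than \<rho>, matters later.\<close>

lemma growth_where_exponent_positive:
  fixes p Q :: "complex poly"
  assumes f: "f holomorphic_on UNIV"
    and ode: "\<And>z. deriv (deriv f) z + h z * exp (poly p z) * deriv f z + poly Q z * f z = 0"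
    and fK: "\<And>z. R0 \<le> norm z \<Longrightarrow> norm (f z) \<le> exp (norm z powr K)" and K: "0 < K"
    and h: "h holomorphic_on UNIV" "h c0 \<noteq> 0"
    and h\<alpha>: "\<And>z. R0 \<le> norm z \<Longrightarrow> norm (h z) \<le> exp (norm z powr \<alpha>)" and \<alpha>: "0 < \<alpha>" "\<alpha> < real n"
    and n: "degree p = n" "1 \<le> n" and lead: "Re (lead_coeff p) = 0" "0 < Im (lead_coeff p)"
    and s0: "0 < s0"
  obtains R C where "1 \<le> R" "0 \<le> C"
    "\<And>r \<theta>. R \<le> r \<Longrightarrow> sin (real n * \<theta>) \<le> - s0 \<Longrightarrow> norm (f (rcis r \<theta>)) \<le> exp (C + 2 * r)"
    "\<And>r \<theta>. R \<le> r \<Longrightarrow> sin (real n * \<theta>) \<le> - s0 \<Longrightarrow> norm (deriv f (rcis r \<theta>)) \<le> exp (C + 2 * r)"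
proof -
  obtain c R1 where c: "0 < c" and R1: "1 \<le> R1" "\<And>r \<theta> w. R1 \<le> r \<Longrightarrow> sin (real n * \<theta>) \<le> - s0 \<Longrightarrow> dist (rcis r \<theta>) w \<le> 1 \<Longrightarrow>
      c * r powr real n \<le> Re (poly p w)"
    by (rule Re_poly_large[OF n lead s0]) blast
  define S where "S = {rcis r \<theta> | r \<theta>. 0 < r \<and> sin (real n * \<theta>) \<le> - s0}"
  obtain D where D: "0 \<le> D" "\<And>z. 1 \<le> norm z \<Longrightarrow> norm (poly Q z) \<le> D * norm z ^ degree Q"
    by (rule poly_upper_bound[of Q]) blast
  define RR where "RR = max R0 (max R1 2)"
  have "\<forall>\<^sub>F r in at_top. \<forall>z \<in> S. norm z = r \<longrightarrow> norm (deriv f z) \<le> 1 + norm (f z)"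
  proof (rule deriv_bound_where_exponent_positive[OF f ode, of RR K c0 \<alpha> "real n" c S "D * 2 ^ degree Q" "real (degree Q)"])
    show "c * norm z powr real n \<le> Re (poly p w)" if "z \<in> S" "RR \<le> norm z" "dist z w \<le> 1" for z w
      using that R1 by (auto simp: S_def RR_def)
    show "norm (poly Q w) \<le> D * 2 ^ degree Q * norm z powr real (degree Q)" if z: "RR \<le> norm z" "dist z w \<le> 1" for z w
    proof -
      have z2: "2 \<le> norm z" using z by (simp add: RR_def)
      have w: "1 \<le> norm w" "norm w \<le> 2 * norm z"
        using z z2 norm_triangle_ineq2[of z w] norm_triangle_ineq2[of w z] by (auto simp: dist_norm norm_minus_commute)
      have "norm (poly Q w) \<le> D * norm w ^ degree Q" using D w by blast
      also have "\<dots> \<le> D * (2 * norm z) ^ degree Q" using D w by (intro mult_left_mono power_mono) auto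
      finally show ?thesis using z2 by (subst powr_realpow) (auto simp: power_mult_distrib)
    qed
  qed (use fK h\<alpha> K h \<alpha> c in \<open>auto simp: RR_def\<close>)
  then obtain R2 where R2: "\<And>z. R2 \<le> norm z \<Longrightarrow> z \<in> S \<Longrightarrow> norm (deriv f z) \<le> 1 + norm (f z)"
    unfolding eventually_at_top_linorder by auto
  define R where "R = max R2 (max R0 1)"
  have R: "R2 \<le> R" "R0 \<le> R" "1 \<le> R" by (auto simp: R_def)
  define B where "B = exp (R powr K)"
  define C where "C = ln (1 + B\<^sup>2)"
  have C: "0 \<le> C" by (simp add: C_def)
  have d: "norm (deriv f (rcis r \<theta>)) \<le> 1 + norm (f (rcis r \<theta>))" if "R \<le> r" "sin (real n * \<theta>) \<le> - s0" for r \<theta>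
  proof (rule R2)
    show "rcis r \<theta> \<in> S" unfolding S_def using that R by (intro CollectI exI[of _ r] exI[of _ \<theta>]) auto
  qed (use that R in auto)
  have b: "norm (f (rcis r \<theta>)) \<le> exp (C + 2 * r)" if r: "R \<le> r" and \<theta>: "sin (real n * \<theta>) \<le> - s0" for r \<theta>
  proof -
    have "norm (f (rcis R \<theta>)) \<le> B" using fK[of "rcis R \<theta>"] R by (simp add: B_def)
    then have fB: "(norm (f (rcis R \<theta>)))\<^sup>2 \<le> B\<^sup>2" by (intro power_mono) auto
    have "1 + (norm (f (rcis r \<theta>)))\<^sup>2 \<le> (1 + (norm (f (rcis R \<theta>)))\<^sup>2) * exp (3 * (r - R))"
      by (rule ray_gronwall[of R "\<lambda>r. f (rcis r \<theta>)" "\<lambda>r. cis \<theta> * deriv f (rcis r \<theta>)"])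
         (use has_vector_derivative_ray[OF f] d \<theta> r in \<open>auto simp: norm_mult\<close>)
    also have "\<dots> \<le> (1 + B\<^sup>2) * exp (4 * r)"
      using fB r R by (intro mult_mono) auto
    also have "\<dots> = exp (C + 4 * r)" unfolding C_def exp_add by (subst exp_ln) (auto intro: add_pos_nonneg)
    also have "\<dots> \<le> (exp (C + 2 * r))\<^sup>2" using C by (simp flip: exp_double)
    finally have "(norm (f (rcis r \<theta>)))\<^sup>2 \<le> (exp (C + 2 * r))\<^sup>2" by linarith
    then show ?thesis by (rule power2_le_imp_le) simp
  qed
  show thesis
  proof (rule that[of R "C + 1"])
    fix r \<theta> :: real assume r: "R \<le> r" and \<theta>: "sin (real n * \<theta>) \<le> - s0"
    have "1 \<le> exp (C + 2 * r)" using C r R by simp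
    then have "norm (deriv f (rcis r \<theta>)) \<le> 2 * exp (C + 2 * r)" using d[OF r \<theta>] b[OF r \<theta>] by linarith
    also have "\<dots> \<le> exp 1 * exp (C + 2 * r)" using exp_ge_add_one_self[of 1] by (intro mult_right_mono) auto
    also have "\<dots> = exp (C + 1 + 2 * r)" by (simp flip: exp_add)
    finally show "norm (deriv f (rcis r \<theta>)) \<le> exp (C + 1 + 2 * r)" .
    show "norm (f (rcis r \<theta>)) \<le> exp (C + 1 + 2 * r)" using b[OF r \<theta>] by (rule order_trans) simp
  qed (use R C in auto)
qed

text \<open>On this ray |h e^p| <= 1 far out, since h grows more slowly than e^p decays, so the
  equation is a perturbation of y'' = \<mu>^2 r^m y. The angle (s + 1) \<theta> in \<mu> is half of
  m \<theta>, from z^m, plus 2 \<theta>, from differentiating twice along the ray.\<close>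

lemma solution_ray_dichotomy:
  fixes p Q :: "complex poly" and \<Lambda> :: complex and m n :: nat and \<theta> :: real
  defines "s \<equiv> real m / 2"
  defines "l \<equiv> Re (\<Lambda> * cis ((s + 1) * \<theta>))"
  assumes f: "f holomorphic_on UNIV"
    and ode: "\<And>z. deriv (deriv f) z + h z * exp (poly p z) * deriv f z + poly Q z * f z = 0"
    and h\<alpha>: "\<And>z. R0 \<le> norm z \<Longrightarrow> norm (h z) \<le> exp (norm z powr \<alpha>)" and \<alpha>: "0 < \<alpha>" "\<alpha> < real n"
    and n: "degree p = n" "1 \<le> n" and lead: "Re (lead_coeff p) = 0" "0 < Im (lead_coeff p)"
    and \<theta>: "0 < sin (real n * \<theta>)"
    and m: "degree Q = m" "2 \<le> m" and \<Lambda>: "\<Lambda>\<^sup>2 = - lead_coeff Q" "0 < l"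
  obtains R E c where "1 \<le> R" "0 \<le> E"
    "\<And>r. R \<le> r \<Longrightarrow> norm (f (rcis r \<theta>)) \<le> exp (c + l / (s + 1) * r powr (s + 1) + E * r powr s)"
    "\<And>r. R \<le> r \<Longrightarrow> norm (deriv f (rcis r \<theta>)) \<le> exp (c + l / (s + 1) * r powr (s + 1) + E * r powr s)"
    "(\<forall>r\<ge>R. norm (f (rcis r \<theta>)) \<le> exp (c - l / (s + 1) * r powr (s + 1) + E * r powr s)) \<or>
     (\<exists>R' c'. \<forall>r\<ge>R'. exp (c' + l / (s + 1) * r powr (s + 1) - E * r powr s) \<le>
         norm (deriv f (rcis r \<theta>)) + norm \<Lambda> * r powr s * norm (f (rcis r \<theta>)))"
proof -
  obtain b R1 where b: "0 < b" and R1: "1 \<le> R1" "\<And>r. R1 \<le> r \<Longrightarrow> Re (poly p (rcis r \<theta>)) \<le> - b * r powr real n"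
    by (rule Re_poly_small[OF n lead \<theta>]) blast
  obtain C where C: "0 \<le> C" "\<And>z. 1 \<le> norm z \<Longrightarrow> norm (poly Q z - lead_coeff Q * z ^ degree Q) \<le> C * norm z ^ (degree Q - 1)"
    using poly_lead_bound[of Q] m by auto
  have "\<forall>\<^sub>F r in at_top. r powr \<alpha> \<le> b * r powr real n" using \<alpha> b by real_asymp
  then obtain R2 where R2: "\<And>r. R2 \<le> r \<Longrightarrow> r powr \<alpha> \<le> b * r powr real n"
    unfolding eventually_at_top_linorder by auto
  define r0 where "r0 = max R0 (max R1 R2)"
  have r0: "1 \<le> r0" using R1 by (simp add: r0_def)
  define e where "e = cis \<theta>"
  have ne: "norm e = 1" by (simp add: e_def)
  define \<mu> where "\<mu> = \<Lambda> * cis ((s + 1) * \<theta>)"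
  have \<mu>: "l = Re \<mu>" "norm \<mu> = norm \<Lambda>" by (simp_all add: l_def \<mu>_def norm_mult)
  have \<mu>2: "\<mu>\<^sup>2 = - lead_coeff Q * e ^ m * e\<^sup>2"
  proof -
    have "(cis ((s + 1) * \<theta>))\<^sup>2 = e ^ m * e\<^sup>2"
    proof -
      have "real 2 * ((s + 1) * \<theta>) = real m * \<theta> + real 2 * \<theta>" by (simp add: s_def algebra_simps)
      then show ?thesis unfolding e_def Complex.DeMoivre cis_mult by (simp only:)
    qed
    then show ?thesis unfolding \<mu>_def power_mult_distrib \<Lambda> by (simp add: mult.assoc)
  qed
  have f': "deriv f holomorphic_on UNIV" using f by (rule holomorphic_deriv) simp
  define y2 where "y2 = (\<lambda>r. e * (e * deriv (deriv f) (rcis r \<theta>)))"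
  have bound: "norm (y2 r - \<mu>\<^sup>2 * of_real (r powr (2 * s)) * f (rcis r \<theta>))
     \<le> max 1 C * (norm (e * deriv f (rcis r \<theta>)) + r powr (2 * s - 1) * norm (f (rcis r \<theta>)))" if r: "r0 \<le> r" for r
  proof -
    define z where "z = rcis r \<theta>"
    have rr: "R0 \<le> r" "R1 \<le> r" "R2 \<le> r" "1 \<le> r" using r r0 by (auto simp: r0_def)
    have nz: "norm z = r" using rr by (simp add: z_def)
    have zm: "z ^ m = of_real (r ^ m) * e ^ m" by (simp add: z_def e_def rcis_def power_mult_distrib)
    have pw: "r powr (2 * s) = r ^ m" "r powr (2 * s - 1) = r ^ (m - 1)"
      using rr m by (auto simp: s_def powr_realpow[symmetric] of_nat_diff)
    have A: "norm (h z * exp (poly p z)) \<le> 1"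
    proof -
      have "norm (h z * exp (poly p z)) \<le> exp (r powr \<alpha>) * exp (- b * r powr real n)"
        unfolding norm_mult norm_exp_eq_Re using h\<alpha>[of z] R1(2)[OF rr(2)] nz rr
        by (intro mult_mono) (auto simp: z_def)
      also have "\<dots> = exp (r powr \<alpha> - b * r powr real n)" by (simp flip: exp_add)
      also have "\<dots> \<le> 1" using R2[OF rr(3)] by simp
      finally show ?thesis .
    qed
    have B: "norm (poly Q z - lead_coeff Q * z ^ m) \<le> C * r ^ (m - 1)" using C(2)[of z] nz rr m by simp
    have f'': "deriv (deriv f) z = - (h z * exp (poly p z) * deriv f z) - poly Q z * f z"
      using ode[of z] by algebra
    have "y2 r - \<mu>\<^sup>2 * of_real (r powr (2 * s)) * f z =
        - (e * (h z * exp (poly p z)) * (e * deriv f z)) - e\<^sup>2 * (poly Q z - lead_coeff Q * z ^ m) * f z"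
      unfolding y2_def z_def[symmetric] f'' \<mu>2 pw zm by (simp add: algebra_simps power2_eq_square)
    also have "norm \<dots> \<le> norm (e * (h z * exp (poly p z)) * (e * deriv f z)) + norm (e\<^sup>2 * (poly Q z - lead_coeff Q * z ^ m) * f z)"
      by (metis norm_minus_cancel norm_triangle_ineq4)
    also have "\<dots> \<le> 1 * norm (e * deriv f z) + C * r ^ (m - 1) * norm (f z)"
      using A B by (intro add_mono) (auto simp: norm_mult norm_power ne intro!: mult_right_mono mult_left_le_one_le)
    also have "\<dots> \<le> max 1 C * norm (e * deriv f z) + max 1 C * r ^ (m - 1) * norm (f z)"
      using rr by (intro add_mono mult_right_mono) auto
    finally show ?thesis unfolding z_def[symmetric] pw by (simp add: algebra_simps)
  qed
  have dy: "((\<lambda>r. f (rcis r \<theta>)) has_vector_derivative e * deriv f (rcis r \<theta>)) (at r)" for r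
    unfolding e_def by (rule has_vector_derivative_ray[OF f])
  have dy1: "((\<lambda>r. e * deriv f (rcis r \<theta>)) has_vector_derivative y2 r) (at r)" for r
    unfolding y2_def e_def by (intro has_vector_derivative_mult_right has_vector_derivative_ray f')
  have side: "0 < Re \<mu>" "1 \<le> s" "0 \<le> max 1 C" using \<Lambda> \<mu> m by (simp_all add: s_def)
  show thesis
  proof (rule ray_dichotomy[OF side(1,2) r0 side(3) dy dy1 bound])
    fix R E c assume R: "r0 \<le> R" "0 \<le> E"
      "\<And>r. R \<le> r \<Longrightarrow> norm (f (rcis r \<theta>)) \<le> exp (c + Re \<mu> / (s + 1) * r powr (s + 1) + E * r powr s)"
      "\<And>r. R \<le> r \<Longrightarrow> norm (e * deriv f (rcis r \<theta>)) \<le> exp (c + Re \<mu> / (s + 1) * r powr (s + 1) + E * r powr s)"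
      "(\<forall>r\<ge>R. norm (f (rcis r \<theta>)) \<le> exp (c - Re \<mu> / (s + 1) * r powr (s + 1) + E * r powr s)) \<or>
     (\<exists>R' c'. \<forall>r\<ge>R'. exp (c' + Re \<mu> / (s + 1) * r powr (s + 1) - E * r powr s) \<le>
         norm (e * deriv f (rcis r \<theta>)) + norm \<mu> * r powr s * norm (f (rcis r \<theta>)))"
    show thesis
      by (rule that[of R E c]) (use R r0 in \<open>auto simp: norm_mult ne \<mu>\<close>)
  qed
qed

section \<open>The local theorem\<close>

text \<open>Provides one margin \<open>s0\<close> valid on all interior rays of an equidistant grid
  in a sector; the sine on [0, pi] is smallest next to the ends.\<close>

lemma sin_multiple_ge:
  assumes "1 \<le> j" "j + 1 \<le> L"
  shows "sin (pi / real L) \<le> sin (real j * pi / real L)"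
proof -
  have L: "0 < real L" "real j + 1 \<le> real L" using assms by linarith+
  have a: "pi / real L \<le> real j * pi / real L" using assms L by (simp add: divide_right_mono)
  have "(real j + 1) * pi \<le> real L * pi" using L by (intro mult_right_mono) auto
  then have b: "real j * pi / real L \<le> pi - pi / real L" using L by (simp add: field_simps)
  have c: "0 < pi / real L" using L by simp
  have mono: "sin x \<le> sin y" if "x \<le> y" "y \<le> pi - x" "0 < x" for x y :: real
  proof (cases "y \<le> pi / 2")
    case True
    then show ?thesis using that by (intro sin_monotone_2pi_le) auto
  next
    case False
    then have "sin x \<le> sin (pi - y)" using that by (intro sin_monotone_2pi_le) auto
    then show ?thesis by simp
  qed
  show ?thesis by (rule mono[OF a b c])
qed

lemma exp_Complex_rcis: "exp (Complex x t) = rcis (exp x) t"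
  by (simp add: exp_eq_polar rcis_def)

lemma exp_powr_exp: "exp x powr a = exp (a * x)" for x a :: real
  by (simp add: powr_def)

text \<open>Here \<open>\<theta> = 0\<close> separates a sector \<open>- \<pi> / n < \<theta> < 0\<close> where \<open>e\<^sup>p\<close> is large from a sector where
  it is small, and the condition on the leading coefficient of \<open>Q\<close> says that the solutions of
  \<open>f'' + Q f = 0\<close> do not oscillate along \<open>\<theta> = 0\<close>.\<close>

lemma finite_order_solution_zero:
  fixes p Q :: "complex poly" and m n :: nat
  assumes f: "f holomorphic_on UNIV"
    and ode: "\<And>z. deriv (deriv f) z + h z * exp (poly p z) * deriv f z + poly Q z * f z = 0"
    and fK: "\<And>z. R0 \<le> norm z \<Longrightarrow> norm (f z) \<le> exp (norm z powr K)" and K: "0 < K"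
    and h: "h holomorphic_on UNIV" "h c0 \<noteq> 0"
    and h\<alpha>: "\<And>z. R0 \<le> norm z \<Longrightarrow> norm (h z) \<le> exp (norm z powr \<alpha>)" and \<alpha>: "0 < \<alpha>" "\<alpha> < real n"
    and n: "degree p = n" "2 \<le> n" and lead: "Re (lead_coeff p) = 0" "0 < Im (lead_coeff p)"
    and m: "degree Q = m" "2 * n < m + 2" and Q: "\<not> (Im (lead_coeff Q) = 0 \<and> 0 \<le> Re (lead_coeff Q))"
    and z: "z \<noteq> 0"
  shows "f z = 0"
proof -
  define s where "s = real m / 2"
  define \<rho> where "\<rho> = s + 1"
  have m2: "2 \<le> m" using m n by linarith
  have s: "1 \<le> s" "s < \<rho>" using m2 by (simp_all add: s_def \<rho>_def)
  have \<rho>n: "real n < \<rho>" using m by (simp add: \<rho>_def s_def)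
  \<comment> \<open>The principal root has nonnegative real part, which is 0 only if the leading
    coefficient of \<open>Q\<close> is real and nonnegative; this is excluded by hypothesis.\<close>
  define \<Lambda> where "\<Lambda> = csqrt (- lead_coeff Q)"
  have \<Lambda>2: "\<Lambda>\<^sup>2 = - lead_coeff Q" by (simp add: \<Lambda>_def)
  have "Re \<Lambda> \<noteq> 0"
  proof
    assume "Re \<Lambda> = 0"
    then have "lead_coeff Q = of_real ((Im \<Lambda>)\<^sup>2)"
      using \<Lambda>2 by (simp add: complex_eq_iff power2_eq_square)
    then show False using Q by simp
  qed
  then have Re\<Lambda>: "0 < Re \<Lambda>" using csqrt_principal[of "- lead_coeff Q"] by (auto simp: \<Lambda>_def)
  \<comment> \<open>\<open>l \<theta> / \<rho>\<close> is the coefficient of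
    \<open>r powr \<rho>\<close> in the exponent of the growing solutions on the ray
    \<theta>.\<close>
  define l where "l = (\<lambda>\<theta>. Re (\<Lambda> * cis (\<rho> * \<theta>)))"
  have "l = (\<lambda>\<theta>. Re \<Lambda> * cos (\<rho> * \<theta>) - Im \<Lambda> * sin (\<rho> * \<theta>))" by (simp add: l_def fun_eq_iff)
  then have "isCont l 0" by (simp only:) (intro continuous_intros)
  moreover have "0 < l 0" using Re\<Lambda> by (simp add: l_def)
  ultimately have "\<forall>\<^sub>F \<theta> in nhds 0. 0 < l \<theta>"
    by (metis isCont_def filterlim_at_within_not_equal order_tendstoD(1) tendsto_at_iff_tendsto_nhds)
  then obtain d where d: "0 < d" "\<And>\<theta>. \<bar>\<theta>\<bar> < d \<Longrightarrow> 0 < l \<theta>"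
    unfolding eventually_nhds_metric by (auto simp: dist_real_def)
  define K' where "K' = max K \<rho>"
  have K': "K \<le> K'" "\<rho> \<le> K'" "0 < K'" using K by (auto simp: K'_def)
  \<comment> \<open>Three margins for \<delta>: \<open>d / 2\<close> keeps \<open>l\<close> positive
    up to the angle \<open>2 * \<delta>\<close>; \<open>pi / (3 * K')\<close> makes strips of width
    \<open>3 * \<delta>\<close> narrow enough for growth of rate \<open>K'\<close>; the last one
    leaves \<open>pi / n - \<delta>\<close> above \<open>pi / \<rho>\<close>, the width beyond which
    decay forces zero.\<close>
  define d' where "d' = min (d / 2) (min (pi / (3 * K')) (pi / real n - pi / \<rho>))"
  have d': "0 < d'" using d K' \<rho>n n by (auto simp: d'_def field_simps)
  obtain L :: nat where L0: "max 4 (pi / (real n * d')) < real L" using reals_Archimedean2 by blast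
  \<comment> \<open>The step divides the opening \<open>pi / n\<close> into L equal parts, so that n
    times a grid angle is a multiple of \<open>pi / L\<close> and \<open>sin_multiple_ge\<close>
    applies.\<close>
  define \<delta> where "\<delta> = pi / (real n * real L)"
  have L: "4 \<le> L" using L0 by linarith
  have n0: "0 < real n" "0 < real L" using n L by linarith+
  have \<delta>0: "0 < \<delta>" using n0 by (simp add: \<delta>_def)
  have "\<delta> < d'"
  proof -
    have "pi / (real n * d') < real L" using L0 by simp
    then have "pi < real L * (real n * d')" using n0 d' by (simp add: pos_divide_less_eq)
    then show ?thesis using n0 by (simp add: \<delta>_def pos_divide_less_eq mult_ac)
  qed
  then have \<delta>: "2 * \<delta> < d" "\<delta> < pi / (3 * K')" "\<delta> < pi / real n - pi / \<rho>" by (simp_all add: d'_def)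
  have \<delta>K: "K' * (3 * \<delta>) < pi" using \<delta>(2) K' by (simp add: field_simps)
  have L\<delta>: "real L * \<delta> = pi / real n" using n0 by (simp add: \<delta>_def)
  define s0 where "s0 = sin (pi / real L)"
  have s0: "0 < s0" unfolding s0_def using L by (intro sin_gt_zero) (auto simp: field_simps)
  have n\<delta>: "real n * (real j * \<delta>) = real j * pi / real L" for j using n0 by (simp add: \<delta>_def)
  have plus: "sin (real n * (- (real j * \<delta>))) \<le> - s0" if "1 \<le> j" "j + 1 \<le> L" for j
    using sin_multiple_ge[OF that] n\<delta>[of j] by (simp add: s0_def)
  have minus: "0 < sin (real n * \<delta>)" "0 < sin (real n * (2 * \<delta>))"
  proof -
    have "0 < sin (real n * (real j * \<delta>))" if "1 \<le> j" "j + 1 \<le> L" for j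
      unfolding n\<delta> using sin_multiple_ge[OF that] s0 by (simp add: s0_def)
    from this[of 1] this[of 2] show "0 < sin (real n * \<delta>)" "0 < sin (real n * (2 * \<delta>))" using L by simp_all
  qed
  have n1: "1 \<le> n" using n by simp
  obtain Rp Cp where Rp: "1 \<le> Rp" "0 \<le> Cp"
    "\<And>r \<theta>. Rp \<le> r \<Longrightarrow> sin (real n * \<theta>) \<le> - s0 \<Longrightarrow> norm (f (rcis r \<theta>)) \<le> exp (Cp + 2 * r)"
    "\<And>r \<theta>. Rp \<le> r \<Longrightarrow> sin (real n * \<theta>) \<le> - s0 \<Longrightarrow> norm (deriv f (rcis r \<theta>)) \<le> exp (Cp + 2 * r)"
    by (rule growth_where_exponent_positive[OF f ode fK K h h\<alpha> \<alpha> n(1) n1 lead s0]) (assumption | rule that)+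
  have lf: "Re (\<Lambda> * cis (\<rho> * t)) = l t" for t by (simp add: l_def)
  have lpos: "0 < l \<delta>" "0 < l (2 * \<delta>)" "0 < l (- \<delta>)" using d(2) \<delta>0 \<delta>(1) by auto
  have \<Lambda>': "0 < Re (\<Lambda> * cis ((real m / 2 + 1) * \<delta>))" "0 < Re (\<Lambda> * cis ((real m / 2 + 1) * (2 * \<delta>)))"
    using lpos by (simp_all add: l_def \<rho>_def s_def)
  obtain R1 E1 c1 where R1: "1 \<le> R1" "0 \<le> E1"
    "\<And>r. R1 \<le> r \<Longrightarrow> norm (f (rcis r \<delta>)) \<le> exp (c1 + l \<delta> / \<rho> * r powr \<rho> + E1 * r powr s)"
    "\<And>r. R1 \<le> r \<Longrightarrow> norm (deriv f (rcis r \<delta>)) \<le> exp (c1 + l \<delta> / \<rho> * r powr \<rho> + E1 * r powr s)"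
    "(\<forall>r\<ge>R1. norm (f (rcis r \<delta>)) \<le> exp (c1 - l \<delta> / \<rho> * r powr \<rho> + E1 * r powr s)) \<or>
     (\<exists>R' c'. \<forall>r\<ge>R'. exp (c' + l \<delta> / \<rho> * r powr \<rho> - E1 * r powr s) \<le>
         norm (deriv f (rcis r \<delta>)) + norm \<Lambda> * r powr s * norm (f (rcis r \<delta>)))"
    by (rule solution_ray_dichotomy[OF f ode h\<alpha> \<alpha> n(1) n1 lead minus(1) m(1) m2 \<Lambda>2 \<Lambda>'(1), folded s_def, folded \<rho>_def, unfolded lf])
       (assumption | rule that)+
  obtain R2 E2 c2 where R2: "1 \<le> R2" "0 \<le> E2"
    "\<And>r. R2 \<le> r \<Longrightarrow> norm (f (rcis r (2 * \<delta>))) \<le> exp (c2 + l (2 * \<delta>) / \<rho> * r powr \<rho> + E2 * r powr s)"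
    "\<And>r. R2 \<le> r \<Longrightarrow> norm (deriv f (rcis r (2 * \<delta>))) \<le> exp (c2 + l (2 * \<delta>) / \<rho> * r powr \<rho> + E2 * r powr s)"
    by (rule solution_ray_dichotomy[OF f ode h\<alpha> \<alpha> n(1) n1 lead minus(2) m(1) m2 \<Lambda>2 \<Lambda>'(2), folded s_def, folded \<rho>_def, unfolded lf])
       (assumption | rule that)+
  define x0 where "x0 = ln (max (max R0 0 + 1) (max Rp (max R1 R2)))"
  have x0: "0 \<le> x0" using Rp by (simp add: x0_def)
  have big: "R0 + 1 \<le> exp x" "Rp \<le> exp x" "R1 \<le> exp x" "R2 \<le> exp x" "1 \<le> exp x" if "x0 \<le> x" for x
  proof -
    have "exp x0 \<le> exp x" using that by simp
    moreover have "exp x0 = max (max R0 0 + 1) (max Rp (max R1 R2))"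
      unfolding x0_def by (rule exp_ln) (simp add: less_max_iff_disj add_nonneg_pos)
    ultimately show "R0 + 1 \<le> exp x" "Rp \<le> exp x" "R1 \<le> exp x" "R2 \<le> exp x" by linarith+
    show "1 \<le> exp x" using that x0 by simp
  qed
  have mono: "exp (a * x) \<le> exp (b * x)" if "a \<le> b" "x0 \<le> x" for a b x
    using that x0 by (auto intro: mult_right_mono)
  \<comment> \<open>Absorbs the shift in the bound for \<open>deriv f\<close>:
    \<open>exp x + 1 \<le> 2 * exp x\<close>.\<close>
  define D where "D = 2 powr K"
  have D: "1 \<le> D" using K by (simp add: D_def ge_one_powr_ge_zero)
  have grow: "norm (f (rcis (exp x) t)) \<le> exp (D * exp (K' * x))"
             "norm (deriv f (rcis (exp x) t)) \<le> exp (D * exp (K' * x))" if x: "x0 \<le> x" for x t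
  proof -
    have 1: "D * exp (K * x) \<le> D * exp (K' * x)" using D K' mono[OF _ x] by (intro mult_left_mono) auto
    have "norm (f (rcis (exp x) t)) \<le> exp (exp x powr K)" using fK[of "rcis (exp x) t"] big[OF x] by simp
    also have "\<dots> \<le> exp (D * exp (K * x))" using D by (simp add: exp_powr_exp mult_le_cancel_right1)
    finally show "norm (f (rcis (exp x) t)) \<le> exp (D * exp (K' * x))" using 1 by (simp add: order_trans)
    have "norm (deriv f (rcis (exp x) t)) \<le> exp ((exp x + 1) powr K)"
      using deriv_bound_finite_order[OF f fK, where z = "rcis (exp x) t"] K big[OF x] by simp
    also have "\<dots> \<le> exp ((2 * exp x) powr K)" using K big[OF x] by (auto intro!: powr_mono2)
    also have "\<dots> = exp (D * exp (K * x))" by (simp add: powr_mult exp_powr_exp D_def)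
    finally show "norm (deriv f (rcis (exp x) t)) \<le> exp (D * exp (K' * x))" using 1 by (simp add: order_trans)
  qed
  have left: "norm (f (rcis (exp x) (- (real j * \<delta>)))) \<le> exp (Cp + 2 * exp (1 * x))"
             "norm (deriv f (rcis (exp x) (- (real j * \<delta>)))) \<le> exp (Cp + 2 * exp (1 * x))"
    if "x0 \<le> x" "1 \<le> j" "j + 1 \<le> L" for x j
    using Rp(3,4)[OF big(2)[OF that(1)] plus[OF that(2,3)]] by simp_all
  show ?thesis
  proof (rule disjE[OF R1(5)])
    assume dec: "\<forall>r\<ge>R1. norm (f (rcis r \<delta>)) \<le> exp (c1 - l \<delta> / \<rho> * r powr \<rho> + E1 * r powr s)"
    define G where "G = (\<lambda>\<zeta>. f (exp \<zeta>))"
    have GC: "G (Complex x t) = f (rcis (exp x) t)" for x t by (simp add: G_def exp_Complex_rcis)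
    have G: "G holomorphic_on UNIV" unfolding G_def
      by (rule holomorphic_on_compose_gen[of exp UNIV f UNIV, unfolded o_def]) (auto intro: holomorphic_intros f)
    \<comment> \<open>Decay moves down by \<delta> per step. The strip has width
      \<open>2 * \<delta>\<close>, with decay known on its upper edge and growth of order 1 on its
      lower edge; decay is gained on the upper half. The condition \<open>k + 1 \<le> L\<close>
      keeps the lower edge on a ray where the exponential factor is large.\<close>
    have P: "k + 1 \<le> L \<Longrightarrow> \<exists>C c. 0 < c \<and> (\<forall>x t. x0 \<le> x \<longrightarrow> \<delta> - real k * \<delta> \<le> t \<longrightarrow> t \<le> \<delta> \<longrightarrow>
        norm (G (Complex x t)) \<le> exp (C - c * exp (\<rho> * x)))" for k
    proof (induction k)
      case 0
      define e where "e = l \<delta> / \<rho> / 2"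
      have e: "0 < e" using lpos s by (simp add: e_def)
      obtain B where B: "\<And>x. E1 * exp (s * x) \<le> e * exp (\<rho> * x) + B"
        using exp_gap[of s \<rho> e E1] s e R1(2) by auto
      have "norm (G (Complex x \<delta>)) \<le> exp (c1 + B - e * exp (\<rho> * x))" if x: "x0 \<le> x" for x
      proof -
        have "norm (G (Complex x \<delta>)) \<le> exp (c1 - (2 * e) * exp (\<rho> * x) + E1 * exp (s * x))"
          using dec[rule_format, OF big(3)[OF x], unfolded exp_powr_exp] unfolding GC by (simp add: e_def)
        also have "\<dots> \<le> exp (c1 + B - e * exp (\<rho> * x))" using B[of x] by simp
        finally show ?thesis .
      qed
      then show ?case using e by (intro exI[of _ "c1 + B"] exI[of _ e]) auto
    next
      case (Suc k)
      then obtain C c where c: "0 < c" and IH: "\<And>x t. x0 \<le> x \<Longrightarrow> \<delta> - real k * \<delta> \<le> t \<Longrightarrow> t \<le> \<delta> \<Longrightarrow>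
        norm (G (Complex x t)) \<le> exp (C - c * exp (\<rho> * x))" by auto
      define a where "a = \<delta> - real k * \<delta>"
      have edge: "a - 2 * \<delta> = - (real (k + 1) * \<delta>)" by (simp add: a_def algebra_simps)
      obtain C' c' where c': "0 < c'" and new: "\<And>x t. x0 \<le> x \<Longrightarrow> a - \<delta> \<le> t \<Longrightarrow> t \<le> a \<Longrightarrow>
        norm (G (Complex x t)) \<le> exp (C' - c' * exp (\<rho> * x))"
      proof (rule Phragmen_Lindelof_strip_decay_down[OF G, of "a - 2 * \<delta>" "a - \<delta>" a K' \<rho> 1 c x0 C Cp 2 0 D])
        show "K' * (a - (a - 2 * \<delta>)) < pi" using \<delta>K K' \<delta>0 by (smt (verit) mult_less_cancel_left_pos)
        show "norm (G (Complex x a)) \<le> exp (C - c * exp (\<rho> * x))" if "x0 \<le> x" for x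
          using IH[of x a] that \<delta>0 by (simp add: a_def)
        show "norm (G (Complex x (a - 2 * \<delta>))) \<le> exp (Cp + 2 * exp (1 * x))" if "x0 \<le> x" for x
          unfolding edge GC by (rule left(1)) (use that Suc.prems in auto)
        show "norm (G (Complex x t)) \<le> exp (0 + D * exp (K' * x))" if "x0 \<le> x" for x t
          using grow(1)[OF that] by (simp add: GC)
      qed (use \<delta>0 K' c s D x0 in auto)
      have "norm (G (Complex x t)) \<le> exp (max C C' - min c c' * exp (\<rho> * x))"
        if x: "x0 \<le> x" and t: "\<delta> - real (Suc k) * \<delta> \<le> t" "t \<le> \<delta>" for x t
      proof -
        have "min c c' * exp (\<rho> * x) \<le> c * exp (\<rho> * x)" "min c c' * exp (\<rho> * x) \<le> c' * exp (\<rho> * x)"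
          by (simp_all add: mult_right_mono)
        then have le: "exp (C - c * exp (\<rho> * x)) \<le> exp (max C C' - min c c' * exp (\<rho> * x))"
                  "exp (C' - c' * exp (\<rho> * x)) \<le> exp (max C C' - min c c' * exp (\<rho> * x))"
          by (simp_all add: diff_mono)
        show ?thesis
        proof (cases "\<delta> - real k * \<delta> \<le> t")
          case True
          then show ?thesis by (rule order_trans[OF IH[OF x _ t(2)] le(1)])
        next
          case False
          then have "a - \<delta> \<le> t" "t \<le> a" using t by (simp_all add: a_def algebra_simps)
          then show ?thesis by (rule order_trans[OF new[OF x] le(2)])
        qed
      qed
      then show ?case using c c' by (intro exI[of _ "max C C'"] exI[of _ "min c c'"]) auto
    qed
    obtain C c where c: "0 < c" and zero: "\<And>x t. x0 \<le> x \<Longrightarrow> \<delta> - real (L - 1) * \<delta> \<le> t \<Longrightarrow> t \<le> \<delta> \<Longrightarrow>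
        norm (G (Complex x t)) \<le> exp (C - c * exp (\<rho> * x))" using P[of "L - 1"] L by auto
    \<comment> \<open>Starting at \<delta> and stopping \<delta> short of the full number of steps
      still leaves more than \<open>pi / \<rho>\<close>; this is where \<open>2 * n < m + 2\<close>
      enters.\<close>
    have width: "real (L - 1) * \<delta> = pi / real n - \<delta>" using L\<delta> L by (simp add: of_nat_diff algebra_simps)
    have "G (Ln z) = 0"
    proof (rule strip_decay_imp_zero[OF G _ _ c zero])
      show "\<delta> - real (L - 1) * \<delta> < \<delta>" using L \<delta>0 by simp
      have "pi / \<rho> < real (L - 1) * \<delta>" using width \<delta>(3) by simp
      then show "pi < \<rho> * (\<delta> - (\<delta> - real (L - 1) * \<delta>))" using s by (simp add: pos_divide_less_eq mult.commute)
    qed auto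
    then show ?thesis using z by (simp add: G_def)
  next
    assume "\<exists>R' c'. \<forall>r\<ge>R'. exp (c' + l \<delta> / \<rho> * r powr \<rho> - E1 * r powr s) \<le>
         norm (deriv f (rcis r \<delta>)) + norm \<Lambda> * r powr s * norm (f (rcis r \<delta>))"
    then obtain R' c' where low: "\<And>r. R' \<le> r \<Longrightarrow> exp (c' + l \<delta> / \<rho> * r powr \<rho> - E1 * r powr s) \<le>
         norm (deriv f (rcis r \<delta>)) + norm \<Lambda> * r powr s * norm (f (rcis r \<delta>))" by blast
    \<comment> \<open>Stated for a general \<open>g\<close> because the lower bound controls only a
      combination of \<open>f\<close> and \<open>deriv f\<close>, so both need the estimate. The
      exponential factor removes exactly the rate \<open>l t / \<rho>\<close> on each ray t: the
      product decays on \<open>- \<delta>\<close>, has only order s left on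
      \<open>2 * \<delta>\<close>, and hence decays on \<delta>.\<close>
    have decay: "\<exists>C c. 0 < c \<and> (\<forall>x\<ge>x0. norm (g (rcis (exp x) \<delta>)) \<le> exp (C - c * exp (\<rho> * x) + l \<delta> / \<rho> * exp (\<rho> * x)))"
      if g: "g holomorphic_on UNIV"
        and g1: "\<And>x. x0 \<le> x \<Longrightarrow> norm (g (rcis (exp x) (- \<delta>))) \<le> exp (Cp + 2 * exp (1 * x))"
        and g2: "\<And>r. R2 \<le> r \<Longrightarrow> norm (g (rcis r (2 * \<delta>))) \<le> exp (c2 + l (2 * \<delta>) / \<rho> * r powr \<rho> + E2 * r powr s)"
        and g3: "\<And>x t. x0 \<le> x \<Longrightarrow> norm (g (rcis (exp x) t)) \<le> exp (D * exp (K' * x))" for g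
    proof -
      define G where "G = (\<lambda>\<zeta>. g (exp \<zeta>) * exp (- (\<Lambda> / of_real \<rho>) * exp (of_real \<rho> * \<zeta>)))"
      have "(\<lambda>\<zeta>. g (exp \<zeta>)) holomorphic_on UNIV"
        by (rule holomorphic_on_compose_gen[of exp UNIV g UNIV, unfolded o_def]) (auto intro: holomorphic_intros g)
      then have G: "G holomorphic_on UNIV" unfolding G_def using s by (intro holomorphic_intros) auto
      have Re_of_real_times: "Re (of_real a * w) = a * Re w" for a w by simp
      have nG: "norm (G (Complex x t)) = norm (g (rcis (exp x) t)) * exp (- (l t / \<rho> * exp (\<rho> * x)))" for x t
      proof -
        have "exp (of_real \<rho> * Complex x t) = of_real (exp (\<rho> * x)) * cis (\<rho> * t)"
          by (simp add: exp_eq_polar)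
        then have "- (\<Lambda> / of_real \<rho>) * exp (of_real \<rho> * Complex x t) = of_real (- exp (\<rho> * x) / \<rho>) * (\<Lambda> * cis (\<rho> * t))"
          by simp
        then have "Re (- (\<Lambda> / of_real \<rho>) * exp (of_real \<rho> * Complex x t)) = - (l t / \<rho> * exp (\<rho> * x))"
          by (simp only: Re_of_real_times l_def) simp
        then show ?thesis unfolding G_def norm_mult norm_exp_eq_Re exp_Complex_rcis by simp
      qed
      define e where "e = l (- \<delta>) / \<rho> / 2"
      have e: "0 < e" using lpos s by (simp add: e_def)
      obtain B where B: "\<And>x. 2 * exp (1 * x) \<le> e * exp (\<rho> * x) + B"
        using exp_gap[of 1 \<rho> e 2] s e by auto
      define D2 where "D2 = D + norm \<Lambda> / \<rho>"
      obtain C c where c: "0 < c" and res: "\<And>x t. x0 \<le> x \<Longrightarrow> - \<delta> \<le> t \<Longrightarrow> t \<le> \<delta> \<Longrightarrow>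
        norm (G (Complex x t)) \<le> exp (C - c * exp (\<rho> * x))"
      proof (rule Phragmen_Lindelof_strip_decay[OF G, of "- \<delta>" \<delta> "2 * \<delta>" K' \<rho> s e x0 "Cp + B" c2 E2 0 D2])
        show "K' * (2 * \<delta> - - \<delta>) < pi" using \<delta>K by (simp add: algebra_simps)
        fix x assume x: "x0 \<le> x"
        have "norm (G (Complex x (- \<delta>))) \<le> exp (Cp + 2 * exp (1 * x)) * exp (- (2 * e * exp (\<rho> * x)))"
          unfolding nG using g1[OF x] by (intro mult_mono) (auto simp: e_def)
        also have "\<dots> = exp (Cp + 2 * exp (1 * x) - 2 * e * exp (\<rho> * x))" by (simp flip: exp_add)
        also have "\<dots> \<le> exp (Cp + B - e * exp (\<rho> * x))" using B[of x] by simp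
        finally show "norm (G (Complex x (- \<delta>))) \<le> exp (Cp + B - e * exp (\<rho> * x))" .
        have "norm (G (Complex x (2 * \<delta>))) \<le> exp (c2 + l (2 * \<delta>) / \<rho> * exp (\<rho> * x) + E2 * exp (s * x)) * exp (- (l (2 * \<delta>) / \<rho> * exp (\<rho> * x)))"
          unfolding nG using g2[OF big(4)[OF x]] by (intro mult_right_mono) (auto simp: exp_powr_exp)
        also have "\<dots> = exp (c2 + E2 * exp (s * x))" by (simp flip: exp_add)
        finally show "norm (G (Complex x (2 * \<delta>))) \<le> exp (c2 + E2 * exp (s * x))" .
        fix t :: real
        have "\<bar>l t\<bar> \<le> norm \<Lambda>" unfolding l_def
          by (rule order_trans[OF abs_Re_le_cmod]) (simp add: norm_mult)
        then have "- l t / \<rho> \<le> norm \<Lambda> / \<rho>" using s by (intro divide_right_mono) auto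
        then have "- l t / \<rho> * exp (\<rho> * x) \<le> norm \<Lambda> / \<rho> * exp (\<rho> * x)" by (rule mult_right_mono) simp
        then have "- (l t / \<rho> * exp (\<rho> * x)) \<le> norm \<Lambda> / \<rho> * exp (\<rho> * x)" by simp
        also have "\<dots> \<le> norm \<Lambda> / \<rho> * exp (K' * x)" using mono[OF K'(2) x] s by (intro mult_left_mono) auto
        finally have "norm (G (Complex x t)) \<le> exp (D * exp (K' * x)) * exp (norm \<Lambda> / \<rho> * exp (K' * x))"
          unfolding nG using g3[OF x, of t] by (intro mult_mono) auto
        also have "\<dots> = exp (0 + D2 * exp (K' * x))" by (simp add: D2_def algebra_simps flip: exp_add)
        finally show "norm (G (Complex x t)) \<le> exp (0 + D2 * exp (K' * x))" .
      qed (use \<delta>0 K' s e D R2 x0 in \<open>auto simp: D2_def\<close>)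
      have "norm (g (rcis (exp x) \<delta>)) \<le> exp (C - c * exp (\<rho> * x) + l \<delta> / \<rho> * exp (\<rho> * x))" if x: "x0 \<le> x" for x
      proof -
        have "norm (g (rcis (exp x) \<delta>)) * exp (- (l \<delta> / \<rho> * exp (\<rho> * x))) \<le> exp (C - c * exp (\<rho> * x))"
          using res[OF x, of \<delta>] \<delta>0 by (simp add: nG)
        then have "norm (g (rcis (exp x) \<delta>)) \<le> exp (C - c * exp (\<rho> * x)) * exp (l \<delta> / \<rho> * exp (\<rho> * x))"
          by (simp add: exp_minus field_simps)
        then show ?thesis by (simp add: exp_add)
      qed
      then show ?thesis using c by blast
    qed
    have f': "deriv f holomorphic_on UNIV" using f by (rule holomorphic_deriv) simp
    have left1: "norm (f (rcis (exp x) (- \<delta>))) \<le> exp (Cp + 2 * exp (1 * x))"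
                "norm (deriv f (rcis (exp x) (- \<delta>))) \<le> exp (Cp + 2 * exp (1 * x))" if "x0 \<le> x" for x
      using left[OF that, of 1] L by simp_all
    obtain C1 b1 where 1: "0 < b1" "\<And>x. x0 \<le> x \<Longrightarrow> norm (f (rcis (exp x) \<delta>)) \<le> exp (C1 - b1 * exp (\<rho> * x) + l \<delta> / \<rho> * exp (\<rho> * x))"
      using decay[OF f left1(1) R2(3) grow(1)] by blast
    obtain C2 b2 where 2: "0 < b2" "\<And>x. x0 \<le> x \<Longrightarrow> norm (deriv f (rcis (exp x) \<delta>)) \<le> exp (C2 - b2 * exp (\<rho> * x) + l \<delta> / \<rho> * exp (\<rho> * x))"
      using decay[OF f' left1(2) R2(4) grow(2)] by blast
    \<comment> \<open>Both sides are freed of the common factor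
      \<open>exp (l \<delta> / \<rho> * r powr \<rho>)\<close>. The gain is of order \<rho>, while
      the uncertainty of the lower bound is of order s only.\<close>
    have "\<forall>\<^sub>F r in at_top. exp (C2 - b2 * r powr \<rho>) + norm \<Lambda> * r powr s * exp (C1 - b1 * r powr \<rho>) < exp (c' - E1 * r powr s)"
    proof -
      define M where "M = norm \<Lambda> + 1"
      have M: "0 < M" by (simp add: M_def add_nonneg_pos)
      have "\<forall>\<^sub>F r in at_top. C2 - b2 * r powr (s + 1) < c' - E1 * r powr s - ln 2"
        using 2(1) s(1) by real_asymp
      moreover have "\<forall>\<^sub>F r in at_top. ln M + s * ln r + C1 - b1 * r powr (s + 1) < c' - E1 * r powr s - ln 2"
        using 1(1) s(1) by real_asymp
      ultimately show ?thesis using eventually_gt_at_top[of 0]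
      proof eventually_elim
        case (elim r)
        have "exp (C2 - b2 * r powr \<rho>) < exp (c' - E1 * r powr s - ln 2)" using elim(1) by (simp add: \<rho>_def)
        moreover have "norm \<Lambda> * r powr s * exp (C1 - b1 * r powr \<rho>) \<le> M * r powr s * exp (C1 - b1 * r powr \<rho>)"
          by (intro mult_right_mono) (auto simp: M_def)
        moreover have "M * r powr s * exp (C1 - b1 * r powr \<rho>) = exp (ln M + s * ln r + C1 - b1 * r powr (s + 1))"
          using M elim(3) by (simp add: exp_add exp_diff powr_def \<rho>_def)
        moreover have "exp (ln M + s * ln r + C1 - b1 * r powr (s + 1)) < exp (c' - E1 * r powr s - ln 2)" using elim(2) by simp
        moreover have "exp (c' - E1 * r powr s - ln 2) = exp (c' - E1 * r powr s) / 2" by (simp add: exp_diff)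
        ultimately show ?case by linarith
      qed
    qed
    then have "\<forall>\<^sub>F r in at_top. exp (C2 - b2 * r powr \<rho>) + norm \<Lambda> * r powr s * exp (C1 - b1 * r powr \<rho>) < exp (c' - E1 * r powr s) \<and> max R' (exp x0) \<le> r"
      using eventually_ge_at_top by (rule eventually_conj)
    then obtain r where r: "exp (C2 - b2 * r powr \<rho>) + norm \<Lambda> * r powr s * exp (C1 - b1 * r powr \<rho>) < exp (c' - E1 * r powr s)"
       "R' \<le> r" "exp x0 \<le> r" using eventually_happens by fastforce
    define x where "x = ln r"
    have rx: "r = exp x" using r(3) by (simp add: x_def) (metis exp_gt_zero exp_ln less_le_trans)
    then have x: "x0 \<le> x" using r(3) by simp
    define y where "y = exp (l \<delta> / \<rho> * r powr \<rho>)"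
    have "exp (c' - E1 * r powr s) * y = exp (c' + l \<delta> / \<rho> * r powr \<rho> - E1 * r powr s)"
      by (simp add: y_def flip: exp_add)
    also have "\<dots> \<le> norm (deriv f (rcis r \<delta>)) + norm \<Lambda> * r powr s * norm (f (rcis r \<delta>))" by (rule low[OF r(2)])
    also have "\<dots> \<le> exp (C2 - b2 * r powr \<rho>) * y + norm \<Lambda> * r powr s * (exp (C1 - b1 * r powr \<rho>) * y)"
      using 1(2)[OF x] 2(2)[OF x]
      by (intro add_mono mult_left_mono) (auto simp: rx exp_powr_exp y_def simp flip: exp_add)
    also have "\<dots> = (exp (C2 - b2 * r powr \<rho>) + norm \<Lambda> * r powr s * exp (C1 - b1 * r powr \<rho>)) * y"
      by (simp add: algebra_simps)
    also have "\<dots> < exp (c' - E1 * r powr s) * y" using r(1) by (intro mult_strict_right_mono) (auto simp: y_def)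
    finally show ?thesis by simp
  qed
qed

section \<open>Infinite order\<close>

text \<open>The factor \<open>c\<close> makes the first derivative an instance of the same form, so
  that the rule can be applied again for the second.\<close>

lemma deriv_rotate:
  assumes "f holomorphic_on UNIV"
  shows "deriv (\<lambda>z. c * f (\<omega> * z)) = (\<lambda>z. \<omega> * c * deriv f (\<omega> * z))"
proof
  fix z
  have "(f has_field_derivative deriv f (\<omega> * z)) (at (\<omega> * z))"
    using assms by (meson UNIV_I holomorphic_derivI open_UNIV)
  then have "((\<lambda>z. f (\<omega> * z)) has_field_derivative deriv f (\<omega> * z) * \<omega>) (at z)"
    by (rule DERIV_chain2[where g = "\<lambda>z. \<omega> * z"]) (auto intro!: derivative_eq_intros)
  then have "((\<lambda>z. c * f (\<omega> * z)) has_field_derivative \<omega> * c * deriv f (\<omega> * z)) (at z)"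
    by (auto intro!: derivative_eq_intros)
  then show "deriv (\<lambda>z. c * f (\<omega> * z)) z = \<omega> * c * deriv f (\<omega> * z)" by (rule DERIV_imp_deriv)
qed

text \<open>The function \<open>f (\<omega> * z)\<close> solves an equation of the same type with
  coefficients \<omega> h(\<omega>z) e^p(\<omega>z) and \<omega>^2 Q(\<omega>z). This explains the
  powers n and m + 2 of \<omega> at the leading coefficients, and it moves the ray through \<omega>
  to \<theta> = 0.\<close>

lemma finite_order_solution_zero_rotated:
  fixes p Q :: "complex poly" and m n :: nat
  assumes f: "f holomorphic_on UNIV"
    and ode: "\<And>z. deriv (deriv f) z + h z * exp (poly p z) * deriv f z + poly Q z * f z = 0"
    and fK: "\<And>z. R0 \<le> norm z \<Longrightarrow> norm (f z) \<le> exp (norm z powr K)" and K: "0 < K"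
    and h: "h holomorphic_on UNIV" "h c0 \<noteq> 0"
    and h\<alpha>: "\<And>z. R0 \<le> norm z \<Longrightarrow> norm (h z) \<le> exp (norm z powr \<alpha>)" and \<alpha>: "0 < \<alpha>" "\<alpha> < real n"
    and n: "degree p = n" "2 \<le> n" and m: "degree Q = m" "2 * n < m + 2"
    and \<omega>: "norm \<omega> = 1" and lead: "Re (lead_coeff p * \<omega> ^ n) = 0" "0 < Im (lead_coeff p * \<omega> ^ n)"
    and Q: "\<not> (Im (lead_coeff Q * \<omega> ^ (m + 2)) = 0 \<and> 0 \<le> Re (lead_coeff Q * \<omega> ^ (m + 2)))"
  shows "f z = 0"
proof -
  have \<omega>0: "\<omega> \<noteq> 0" using \<omega> by auto
  have zero: "f z = 0" if z: "z \<noteq> 0" for z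
  proof -
    define g where "g = (\<lambda>z. f (\<omega> * z))"
    define p' where "p' = pcompose p [:0, \<omega>:]"
    define Q' where "Q' = smult (\<omega>\<^sup>2) (pcompose Q [:0, \<omega>:])"
    have "g (z / \<omega>) = 0"
    proof (rule finite_order_solution_zero[of g "\<lambda>z. \<omega> * h (\<omega> * z)" p' Q' R0 K "c0 / \<omega>" \<alpha> n m])
      show "g holomorphic_on UNIV" unfolding g_def
        by (rule holomorphic_on_compose_gen[of "\<lambda>z. \<omega> * z" UNIV f UNIV, unfolded o_def]) (auto intro: holomorphic_intros f)
      have "(\<lambda>z. h (\<omega> * z)) holomorphic_on UNIV"
        by (rule holomorphic_on_compose_gen[of "\<lambda>z. \<omega> * z" UNIV h UNIV, unfolded o_def]) (auto intro: holomorphic_intros h)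
      then show "(\<lambda>z. \<omega> * h (\<omega> * z)) holomorphic_on UNIV" by (intro holomorphic_intros)
      have g1: "deriv g = (\<lambda>z. \<omega> * deriv f (\<omega> * z))" using deriv_rotate[OF f, of 1 \<omega>] by (simp add: g_def)
      have "deriv f holomorphic_on UNIV" using f by (rule holomorphic_deriv) simp
      then have g2: "deriv (deriv g) = (\<lambda>z. \<omega>\<^sup>2 * deriv (deriv f) (\<omega> * z))"
        unfolding g1 deriv_rotate[OF \<open>deriv f holomorphic_on UNIV\<close>] by (simp add: power2_eq_square)
      fix w
      have "deriv (deriv g) w + \<omega> * h (\<omega> * w) * exp (poly p' w) * deriv g w + poly Q' w * g w =
        \<omega>\<^sup>2 * (deriv (deriv f) (\<omega> * w) + h (\<omega> * w) * exp (poly p (\<omega> * w)) * deriv f (\<omega> * w) + poly Q (\<omega> * w) * f (\<omega> * w))"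
        unfolding g2 unfolding g1 by (simp add: p'_def Q'_def g_def poly_pcompose algebra_simps power2_eq_square)
      then show "deriv (deriv g) w + \<omega> * h (\<omega> * w) * exp (poly p' w) * deriv g w + poly Q' w * g w = 0"
        using ode by simp
      show "norm (g w) \<le> exp (norm w powr K)" if "R0 \<le> norm w"
        using fK[of "\<omega> * w"] that \<omega> by (simp add: g_def norm_mult)
      show "norm (\<omega> * h (\<omega> * w)) \<le> exp (norm w powr \<alpha>)" if "R0 \<le> norm w"
        using h\<alpha>[of "\<omega> * w"] that \<omega> by (simp add: norm_mult)
    next
      have lp: "lead_coeff p' = lead_coeff p * \<omega> ^ n"
        unfolding p'_def using \<omega>0 n by (subst lead_coeff_comp) auto
      show "Re (lead_coeff p') = 0" "0 < Im (lead_coeff p')" unfolding lp by fact+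
      have "lead_coeff Q' = \<omega>\<^sup>2 * (lead_coeff Q * \<omega> ^ m)"
        unfolding Q'_def lead_coeff_smult using \<omega>0 m by (subst lead_coeff_comp) auto
      then have lQ: "lead_coeff Q' = lead_coeff Q * \<omega> ^ (m + 2)" by (simp add: power_add power2_eq_square algebra_simps)
      show "\<not> (Im (lead_coeff Q') = 0 \<and> 0 \<le> Re (lead_coeff Q'))" unfolding lQ by fact
      show "degree p' = n" "degree Q' = m" using n m \<omega>0 by (simp_all add: p'_def Q'_def degree_pcompose)
    qed (use h \<alpha> K n m \<omega>0 z in auto)
    then show ?thesis using \<omega>0 by (simp add: g_def)
  qed
  show ?thesis
  \<comment> \<open>The logarithmic coordinate misses the origin, so the value there comes from the
    identity theorem.\<close>
  proof (rule analytic_continuation[OF f, of "- {0}" 0])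
    have "insert 0 (- {0}) = (UNIV :: complex set)" by auto
    then show "0 islimpt - {0::complex}" using islimpt_UNIV[of "0::complex"] islimpt_insert by metis
  qed (use zero in auto)
qed

theorem theorem1:
  fixes p Q :: "complex poly" and h f :: "complex \<Rightarrow> complex" and n m :: nat
  assumes "degree p = n" and "n \<ge> 2"
    and "h holomorphic_on UNIV" and "\<exists>z. h z \<noteq> 0"
    and "growth_order h < ereal (real n)"
    and "degree Q = m" and "m \<ge> 1"
    and "m + 2 > 2 * n" and "\<not> n dvd m + 2"
    and "is_entire_solution (\<lambda>z. h z * exp (poly p z)) (poly Q) f"
    and "\<exists>z. f z \<noteq> 0"
  shows "growth_order f = \<infinity>"
proof (rule ccontr)
  assume "growth_order f \<noteq> \<infinity>"
  then have "growth_order f < \<infinity>" by simp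
  then obtain K1 where "growth_order f < ereal K1" using ereal_dense2 by blast
  then have K1: "growth_order f < ereal (max K1 1)" by (rule less_le_trans) simp
  \<comment> \<open>The exponent for \<open>h\<close> has to be positive and below n;
    \<open>max \<alpha>1 1\<close> is both, because n is at least 2.\<close>
  obtain \<alpha>1 where \<alpha>1: "growth_order h < ereal \<alpha>1" "ereal \<alpha>1 < ereal (real n)" using ereal_dense2[OF assms(5)] by blast
  then have \<alpha>2: "growth_order h < ereal (max \<alpha>1 1)" by (meson ereal_less_eq(3) less_le_trans max.cobounded1)
  have f: "f holomorphic_on UNIV"
    and ode: "\<And>z. deriv (deriv f) z + h z * exp (poly p z) * deriv f z + poly Q z * f z = 0"
    using assms(10) by (auto simp: is_entire_solution_def)
  obtain R1 where R1: "\<And>z. norm z \<ge> R1 \<Longrightarrow> norm (f z) \<le> exp (norm z powr max K1 1)"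
    using growth_order_less_imp_bound[OF f K1] by metis
  obtain R2 where R2: "\<And>z. norm z \<ge> R2 \<Longrightarrow> norm (h z) \<le> exp (norm z powr max \<alpha>1 1)"
    using growth_order_less_imp_bound[OF assms(3) \<alpha>2] by metis
  obtain c0 where c0: "h c0 \<noteq> 0" using assms(4) by blast
  obtain z0 where z0: "f z0 \<noteq> 0" using assms(11) by blast
  define a where "a = lead_coeff p"
  define b where "b = lead_coeff Q"
  have a: "a \<noteq> 0" using assms(1,2) by (auto simp: a_def)
  have b: "b \<noteq> 0" using assms(6,7) by (auto simp: b_def)
  \<comment> \<open>Every \<omega> that turns the leading coefficient of \<open>p\<close> into i|a|
    must be a Stokes direction of \<open>Q\<close>, since otherwise f = 0.\<close>
  have real_dir: "Im (b * \<omega> ^ (m + 2)) = 0 \<and> 0 \<le> Re (b * \<omega> ^ (m + 2))"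
    if \<omega>: "norm \<omega> = 1" "a * \<omega> ^ n = \<i> * of_real (norm a)" for \<omega>
  proof (rule ccontr)
    assume crit: "\<not> ?thesis"
    have "f z0 = 0"
      by (rule finite_order_solution_zero_rotated[OF f ode, of "max R1 R2" "max K1 1" c0 "max \<alpha>1 1" n m \<omega>])
         (use R1 R2 c0 assms \<alpha>1 \<omega> crit a in \<open>auto simp: a_def b_def\<close>)
    then show False using z0 by simp
  qed
  define \<phi> where "\<phi> = Arg (\<i> * of_real (norm a) / a)"
  have cis\<phi>: "cis \<phi> = \<i> * of_real (norm a) / a"
    unfolding \<phi>_def using a by (subst cis_Arg) (auto simp: sgn_eq norm_mult norm_divide)
  define \<omega>0 where "\<omega>0 = cis (\<phi> / real n)"
  have n0: "0 < real n" using assms(2) by simp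
  have \<omega>0n: "\<omega>0 ^ n = cis \<phi>" unfolding \<omega>0_def Complex.DeMoivre using n0 by simp
  \<comment> \<open>Rotation by t leads to the next boundary ray of the same orientation: it
    preserves the normalisation of \<open>p\<close> and multiplies the leading coefficient of
    \<open>Q\<close> by \<open>cis (real (m + 2) * t)\<close>.\<close>
  define t where "t = 2 * pi / real n"
  have tn: "cis t ^ n = 1" unfolding t_def Complex.DeMoivre using n0 by simp
  define A where "A = b * \<omega>0 ^ (m + 2)"
  have 0: "Im A = 0 \<and> 0 \<le> Re A"
    unfolding A_def by (rule real_dir) (use a in \<open>auto simp: \<omega>0n cis\<phi>, simp add: \<omega>0_def\<close>)
  have 1: "Im (b * (\<omega>0 * cis t) ^ (m + 2)) = 0 \<and> 0 \<le> Re (b * (\<omega>0 * cis t) ^ (m + 2))"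
    by (rule real_dir) (use a in \<open>auto simp: power_mult_distrib tn \<omega>0n cis\<phi> norm_mult, simp add: \<omega>0_def\<close>)
  have eq: "b * (\<omega>0 * cis t) ^ (m + 2) = A * cis (real (m + 2) * t)"
    unfolding A_def power_mult_distrib Complex.DeMoivre by (simp only: mult.assoc)
  have 2: "Im (A * cis (real (m + 2) * t)) = 0" "0 \<le> Re (A * cis (real (m + 2) * t))"
    using 1[unfolded eq] by blast+
  have "A \<noteq> 0" using b by (simp add: A_def \<omega>0_def)
  then have A: "0 < Re A" "Im A = 0" using 0 by (auto simp: complex_eq_iff)
  then have "sin (real (m + 2) * t) = 0" "0 \<le> cos (real (m + 2) * t)" using 2 by (simp_all add: zero_le_mult_iff)
  \<comment> \<open>Besides reality the sign is needed: it excludes cosine -1, which would allow (m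
    + 2)/n to be half an odd integer.\<close>
  then have "cos (real (m + 2) * t) = 1" using sin_zero_abs_cos_one by fastforce
  then obtain k :: int where "real (m + 2) * t = of_int k * 2 * pi" using cos_one_2pi_int by blast
  then have "(2 * pi) * real (m + 2) = (2 * pi) * (of_int k * real n)" using n0 by (simp add: t_def field_simps)
  then have "real (m + 2) = of_int k * real n" by (subst (asm) mult_left_cancel) auto
  then have "int (m + 2) = k * int n" by (metis of_int_eq_iff of_int_mult of_int_of_nat_eq)
  then have "int n dvd int (m + 2)" by simp
  then show False using assms(9) by (simp only: int_dvd_int_iff)
qed

end
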